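(* Define $$\lambda_-=\sup\left\{\inf_{x\in\mathbb{R}^n}\{\Delta\phi(x)+f(x)\}:\ \phi\in C^2(\mathbb{R}^n),\ |D\phi|\le1\right\}$$ and $$\lambda_+=\inf\left\{\sup_{|D\psi(x)|<1}\{\Delta\psi(x)+f(x)\}:\ \psi\in C^2(\mathbb{R}^n),\ \liminf_{|x|\to\infty}\frac{\psi(x)}{|x|}\ge1\right\},$$ where the inner supremum is over all $x\in\mathbb{R}^n$ with $|D\psi(x)|<1$. (i) Then $\lambda_-=\lambda^*\le\lambda_+$. (ii) Moreover, if there is a supersolution $\psi^*\in C^2(\mathbb{R}^n)$ of $$\max\{\lambda^*-\Delta u-f,\ |Du|-1\}=0,\quad x\in\mathbb{R}^n,$$ such that $\liminf_{|x|\to\infty}\psi^*(x)/|x|\ge1$, then $\lambda^*=\lambda_+$.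
   Context: Standing assumptions: $f\in C^\infty(\mathbb{R}^n)$ is convex, non-negative, and superlinear, i.e. $\lim_{|x|\to\infty}f(x)/|x|=+\infty$. For $\lambda\in\mathbb{R}$, $u\in USC(\mathbb{R}^n)$ is a viscosity subsolution of $\max\{\lambda-\Delta u-f,|Du|-1\}=0$ if $\max\{\lambda-\Delta\varphi(x_0)-f(x_0),|D\varphi(x_0)|-1\}\le 0$ whenever $\varphi\in C^2(\mathbb{R}^n)$ and $u-\varphi$ has a local maximum at $x_0$. $v\in LSC(\mathbb{R}^n)$ is a viscosity supersolution if $\max\{\lambda-\Delta\psi(y_0)-f(y_0),|D\psi(y_0)|-1\}\ge 0$ whenever $\psi\in C^2(\mathbb{R}^n)$ and $v-\psi$ has a local minimum at $y_0$. A viscosity solution is a continuous function that is both. (For a $C^2$ function, being a supersolution means that the inequality $\max\{\lambda-\Delta v-f,|Dv|-1\}\ge0$ holds pointwise.) $\lambda^*$ denotes the unique real number for which $\max\{\lambda^*-\Delta u-f,|Du|-1\}=0$ in $\mathbb{R}^n$ has a viscosity solution $u\in C(\mathbb{R}^n)$ with $\lim_{|x|\to\infty}u(x)/|x|=1$. *)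

theory Defs
  imports "HOL-Analysis.Analysis"
begin

definition partial_deriv :: "'n \<Rightarrow> (real ^ 'n \<Rightarrow> real) \<Rightarrow> real ^ 'n \<Rightarrow> real" where
  "partial_deriv i f x = frechet_derivative f (at x) (axis i 1)"

text \<open>
  The predicate \<open>Ck k f\<close> is $f \in C^k(\mathbb{R}^n)$. Differentiability is asked for at every level
  because \<^const>\<open>frechet_derivative\<close> is an arbitrary value where the derivative does not exist.
\<close>

fun Ck :: "nat \<Rightarrow> (real ^ 'n \<Rightarrow> real) \<Rightarrow> bool" where
  "Ck 0 f \<longleftrightarrow> continuous_on UNIV f"
| "Ck (Suc k) f \<longleftrightarrow> f differentiable_on UNIV \<and> (\<forall>i. Ck k (partial_deriv i f))"

definition Cinf :: "(real ^ 'n \<Rightarrow> real) \<Rightarrow> bool" where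
  "Cinf f \<longleftrightarrow> (\<forall>k. Ck k f)"

definition grad :: "(real ^ 'n \<Rightarrow> real) \<Rightarrow> real ^ 'n \<Rightarrow> real ^ 'n" where
  "grad f x = (\<chi> i. partial_deriv i f x)"

definition laplacian :: "(real ^ 'n \<Rightarrow> real) \<Rightarrow> real ^ 'n \<Rightarrow> real" where
  "laplacian f x = (\<Sum>i\<in>UNIV. partial_deriv i (partial_deriv i f) x)"

definition usc :: "('a::topological_space \<Rightarrow> real) \<Rightarrow> bool" where
  "usc u \<longleftrightarrow> (\<forall>x0. \<forall>c > u x0. \<forall>\<^sub>F x in nhds x0. u x < c)"

definition lsc :: "('a::topological_space \<Rightarrow> real) \<Rightarrow> bool" where
  "lsc u \<longleftrightarrow> (\<forall>x0. \<forall>c < u x0. \<forall>\<^sub>F x in nhds x0. c < u x)"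

definition local_max_at :: "('a::topological_space \<Rightarrow> real) \<Rightarrow> 'a \<Rightarrow> bool" where
  "local_max_at g x0 \<longleftrightarrow> (\<forall>\<^sub>F x in nhds x0. g x \<le> g x0)"

definition local_min_at :: "('a::topological_space \<Rightarrow> real) \<Rightarrow> 'a \<Rightarrow> bool" where
  "local_min_at g x0 \<longleftrightarrow> (\<forall>\<^sub>F x in nhds x0. g x0 \<le> g x)"

text \<open>The left-hand side of the equation $\max\{\lambda - \Delta\varphi - f, |D\varphi| - 1\} = 0$
  at the point $x$.\<close>

definition pde_op :: "(real ^ 'n \<Rightarrow> real) \<Rightarrow> real \<Rightarrow> (real ^ 'n \<Rightarrow> real) \<Rightarrow> real ^ 'n \<Rightarrow> real" where
  "pde_op f lam \<phi> x = max (lam - laplacian \<phi> x - f x) (norm (grad \<phi> x) - 1)"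

definition visc_subsolution :: "(real ^ 'n \<Rightarrow> real) \<Rightarrow> real \<Rightarrow> (real ^ 'n \<Rightarrow> real) \<Rightarrow> bool" where
  "visc_subsolution f lam u \<longleftrightarrow> usc u \<and>
     (\<forall>\<phi> x0. Ck 2 \<phi> \<and> local_max_at (\<lambda>x. u x - \<phi> x) x0 \<longrightarrow> pde_op f lam \<phi> x0 \<le> 0)"

definition visc_supersolution :: "(real ^ 'n \<Rightarrow> real) \<Rightarrow> real \<Rightarrow> (real ^ 'n \<Rightarrow> real) \<Rightarrow> bool" where
  "visc_supersolution f lam v \<longleftrightarrow> lsc v \<and>
     (\<forall>\<psi> y0. Ck 2 \<psi> \<and> local_min_at (\<lambda>x. v x - \<psi> x) y0 \<longrightarrow> pde_op f lam \<psi> y0 \<ge> 0)"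

definition visc_solution :: "(real ^ 'n \<Rightarrow> real) \<Rightarrow> real \<Rightarrow> (real ^ 'n \<Rightarrow> real) \<Rightarrow> bool" where
  "visc_solution f lam u \<longleftrightarrow>
     continuous_on UNIV u \<and> visc_subsolution f lam u \<and> visc_supersolution f lam u"

text \<open>$\lambda^*$ is the unique real number with this property. The theorem is stated for every real
  number having it; uniqueness is not assumed.\<close>

definition is_eigenvalue :: "(real ^ 'n \<Rightarrow> real) \<Rightarrow> real \<Rightarrow> bool" where
  "is_eigenvalue f lam \<longleftrightarrow>
     (\<exists>u. visc_solution f lam u \<and> ((\<lambda>x. u x / norm x) \<longlongrightarrow> 1) at_infinity)"

definition superlinear :: "(real ^ 'n \<Rightarrow> real) \<Rightarrow> bool" where
  "superlinear f \<longleftrightarrow> filterlim (\<lambda>x. f x / norm x) at_top at_infinity"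

definition liminf_growth_ge_1 :: "(real ^ 'n \<Rightarrow> real) \<Rightarrow> bool" where
  "liminf_growth_ge_1 \<psi> \<longleftrightarrow> Liminf at_infinity (\<lambda>x. ereal (\<psi> x / norm x)) \<ge> 1"

text \<open>
  The suprema and infima are taken in the extended reals: for a given $\phi$ the inner infimum can be
  $-\infty$, and for a given $\psi$ the inner supremum can be $+\infty$.
\<close>

definition lambda_minus :: "(real ^ 'n \<Rightarrow> real) \<Rightarrow> ereal" where
  "lambda_minus f =
     (SUP \<phi>\<in>{\<phi>. Ck 2 \<phi> \<and> (\<forall>x. norm (grad \<phi> x) \<le> 1)}. INF x. ereal (laplacian \<phi> x + f x))"

definition lambda_plus :: "(real ^ 'n \<Rightarrow> real) \<Rightarrow> ereal" where
  "lambda_plus f =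
     (INF \<psi>\<in>{\<psi>. Ck 2 \<psi> \<and> liminf_growth_ge_1 \<psi>}.
        SUP x\<in>{x. norm (grad \<psi> x) < 1}. ereal (laplacian \<psi> x + f x))"

end

theory Submission
  imports Defs "HOL-Probability.Distributions"
begin

text \<open>
  Let \<open>u\<close> be a viscosity solution for \<open>\<lambda>\<^sup>*\<close> with \<open>u(x)/|x| \<rightarrow> 1\<close>. Three of the four inequalities come from testing
  \<open>u\<close> with a rescaled competitor. If \<open>|D\<phi>| \<le> 1\<close>, then \<open>u - \<theta>\<phi>\<close> has a minimum for every \<open>\<theta> < 1\<close>, and the
  supersolution property there forbids \<open>\<Delta>\<phi> + f \<ge> \<mu> > \<lambda>\<^sup>*\<close> (\<open>classical_subsolution_bound\<close>). If \<open>\<psi>\<close> has growth at least 1, then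
  \<open>u - \<psi>/\<theta>\<close> has a maximum, at which \<open>|D\<psi>| < 1\<close> and \<open>\<Delta>\<psi> + f \<ge> \<theta>\<lambda>\<^sup>*\<close>
  (\<open>classical_supersolution_bound\<close>). A \<open>C\<^sup>2\<close> supersolution satisfies its inequality pointwise, as it is its own test function,
  and so it is a competitor for \<open>\<lambda>\<^sub>+\<close> with value at most \<open>\<lambda>\<^sup>*\<close>.

  The substance is \<open>\<lambda>\<^sub>- \<ge> \<lambda>\<^sup>*\<close>: the merely Lipschitz subsolution \<open>u\<close> must be replaced by a \<open>C\<^sup>2\<close> function with gradient at
  most 1 and nearly the same lower bound on \<open>\<Delta>u + f\<close> (\<open>exists_smooth_subsolution\<close>). Two difficulties arise. Mollifying \<open>u\<close>
  also mollifies \<open>f\<close>, which need not be uniformly continuous at infinity; and a viscosity inequality is not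
  an inequality between distributions without further argument.

  For the first, \<open>\<theta>u\<close> with \<open>\<theta> < 1\<close> is replaced by its maximum with a smooth convex cone \<open>w\<close> of slope 1, which wins outside a
  compact set and, after a shift, only where \<open>f \<ge> \<lambda>\<^sup>*\<close>. There \<open>\<Delta>w \<ge> 0\<close> is enough. What remains to be smoothed is the
  compactly supported excess \<open>p = max(\<theta>u - w, 0)\<close>.

  For the second, \<open>p\<close> is smoothed by the resolvent of the Laplacian, \<open>q = (1 - h\<Delta>)\<^sup>-\<^sup>1 p\<close>, built from the heat kernel. Because
  \<open>h\<Delta>q = q - p\<close>, the wanted lower bound on \<open>\<Delta>q\<close> is an upper bound on \<open>p - q\<close>, a quantity to which the maximum principle
  applies: where \<open>p - q - h\<theta>(f - \<lambda>\<^sup>*)\<close> is largest and \<open>p > 0\<close>, \<open>u\<close> is touched from above by a smooth function involving \<open>q\<close>,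
  and the definition of viscosity subsolution gives exactly the inequality needed. Averaging does not increase Lipschitz
  constants, and the error from not averaging \<open>w\<close> is controlled by the small curvature of \<open>w\<close>.
\<close>

section \<open>Functions of class \<open>C\<^sup>2\<close>\<close>

lemma partial_deriv_eq:
  assumes "(f has_derivative (\<lambda>h. g \<bullet> h)) (at x)"
  shows "partial_deriv i f x = g $ i"
proof -
  have "frechet_derivative f (at x) = (\<lambda>h. g \<bullet> h)"
    using frechet_derivative_at[OF assms] by simp
  then show ?thesis by (simp add: partial_deriv_def inner_axis)
qed

lemma grad_eq:
  assumes "(f has_derivative (\<lambda>h. g \<bullet> h)) (at x)"
  shows "grad f x = g"
  using partial_deriv_eq[OF assms] by (simp add: grad_def vec_eq_iff)

lemma has_derivative_grad:
  fixes f :: "real ^ 'n \<Rightarrow> real"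
  assumes "f differentiable (at x)"
  shows "(f has_derivative (\<lambda>h. grad f x \<bullet> h)) (at x)"
proof -
  let ?D = "frechet_derivative f (at x)"
  have D: "(f has_derivative ?D) (at x)"
    using assms by (simp add: frechet_derivative_works)
  interpret linear ?D using D by (rule has_derivative_linear)
  have "?D h = grad f x \<bullet> h" for h
  proof -
    have "?D h = ?D (\<Sum>i\<in>UNIV. h $ i *\<^sub>R axis i 1)"
      by (simp add: basis_expansion[of h, unfolded scalar_mult_eq_scaleR])
    also have "\<dots> = grad f x \<bullet> h"
      by (simp add: sum scale inner_vec_def grad_def partial_deriv_def mult.commute)
    finally show ?thesis .
  qed
  then have "?D = (\<lambda>h. grad f x \<bullet> h)" by blast
  with D show ?thesis by simp
qed

lemma Ck_2_iff:
  "Ck 2 f \<longleftrightarrow> f differentiable_on UNIV \<and> (\<forall>i. partial_deriv i f differentiable_on UNIV \<and>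
    (\<forall>j. continuous_on UNIV (partial_deriv j (partial_deriv i f))))"
  by (simp add: numeral_2_eq_2)

text \<open>
  The way every concrete \<^term>\<open>Ck 2\<close> statement below is obtained: it trades the iterated
  \<^const>\<open>partial_deriv\<close> of the definition for one explicit gradient and explicit rows of the Hessian.
\<close>

lemma C2_I:
  fixes f :: "real ^ 'n \<Rightarrow> real"
  assumes f: "\<And>x. (f has_derivative (\<lambda>h. g x \<bullet> h)) (at x)"
    and g: "\<And>i x. ((\<lambda>x. g x $ i) has_derivative (\<lambda>h. H i x \<bullet> h)) (at x)"
    and H: "\<And>i. continuous_on UNIV (H i)"
  shows C2_I_Ck: "Ck 2 f" and C2_I_grad: "grad f x = g x"
    and C2_I_laplacian: "laplacian f x = (\<Sum>i\<in>UNIV. H i x $ i)"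
proof -
  have 1: "partial_deriv i f = (\<lambda>x. g x $ i)" for i
    using partial_deriv_eq[OF f] by auto
  have 2: "partial_deriv j (partial_deriv i f) = (\<lambda>x. H i x $ j)" for i j
    unfolding 1 using partial_deriv_eq[OF g] by auto
  have "f differentiable_on UNIV" "(\<lambda>x. g x $ i) differentiable_on UNIV" for i
    using f g by (auto simp: differentiable_on_def differentiable_def)
  then show "Ck 2 f"
    unfolding Ck_2_iff 2 using H by (auto simp: 1 intro!: continuous_intros)
  show "grad f x = g x" by (rule grad_eq[OF f])
  show "laplacian f x = (\<Sum>i\<in>UNIV. H i x $ i)" by (simp add: laplacian_def 2)
qed

lemma C2_has_derivative:
  assumes "Ck 2 f"
  shows "(f has_derivative (\<lambda>h. grad f x \<bullet> h)) (at x)"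
  using assms by (intro has_derivative_grad) (auto simp: Ck_2_iff differentiable_on_def)

lemma C2_has_derivative_grad:
  assumes "Ck 2 f"
  shows "((\<lambda>x. grad f x $ i) has_derivative (\<lambda>h. grad (partial_deriv i f) x \<bullet> h)) (at x)"
  using assms
  by (simp add: grad_def[of f], intro has_derivative_grad) (auto simp: Ck_2_iff differentiable_on_def)

lemma C2_continuous_hessian:
  assumes "Ck 2 f"
  shows "continuous_on UNIV (grad (partial_deriv i f))"
  using assms unfolding grad_def Ck_2_iff by (auto intro!: continuous_intros)

lemma laplacian_eq_sum_grad: "laplacian f x = (\<Sum>i\<in>UNIV. grad (partial_deriv i f) x $ i)"
  by (simp add: laplacian_def grad_def)

lemma C2_continuous:
  assumes "Ck 2 f" shows "continuous_on UNIV f"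
  using assms by (auto simp: Ck_2_iff intro: differentiable_imp_continuous_on)

lemma C2_continuous_laplacian:
  assumes "Ck 2 f" shows "continuous_on UNIV (laplacian f)"
  unfolding laplacian_def using assms by (auto simp: Ck_2_iff intro!: continuous_intros)

lemma C2_lincomb:
  fixes f g :: "real ^ 'n \<Rightarrow> real" and a b c :: real
  assumes f: "Ck 2 f" and g: "Ck 2 g"
  defines "F \<equiv> \<lambda>x. a * f x + b * g x + c"
  shows C2_lincomb_Ck: "Ck 2 F"
    and grad_lincomb: "grad F x = a *\<^sub>R grad f x + b *\<^sub>R grad g x"
    and laplacian_lincomb: "laplacian F x = a * laplacian f x + b * laplacian g x"
proof -
  let ?G = "\<lambda>x. a *\<^sub>R grad f x + b *\<^sub>R grad g x"
  let ?H = "\<lambda>i x. a *\<^sub>R grad (partial_deriv i f) x + b *\<^sub>R grad (partial_deriv i g) x"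
  have 1: "(F has_derivative (\<lambda>h. ?G x \<bullet> h)) (at x)" for x
    unfolding F_def
    by (rule derivative_eq_intros C2_has_derivative[OF f] C2_has_derivative[OF g] refl)+
       (auto simp: inner_add_left)
  have 2: "((\<lambda>x. ?G x $ i) has_derivative (\<lambda>h. ?H i x \<bullet> h)) (at x)" for i x
    unfolding vector_add_component vector_scaleR_component
    by (rule derivative_eq_intros C2_has_derivative_grad[OF f] C2_has_derivative_grad[OF g] refl)+
       (auto simp: inner_add_left)
  have 3: "continuous_on UNIV (?H i)" for i
    by (intro continuous_intros C2_continuous_hessian f g)
  show "Ck 2 F" "grad F x = ?G x"
    by (fact C2_I[OF 1 2 3])+
  show "laplacian F x = a * laplacian f x + b * laplacian g x"
    by (simp add: C2_I_laplacian[OF 1 2 3] laplacian_eq_sum_grad[of f] laplacian_eq_sum_grad[of g]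
      sum.distrib sum_distrib_left)
qed

lemma C2_scale:
  fixes f :: "real ^ 'n \<Rightarrow> real"
  assumes f: "Ck 2 f"
  shows C2_scale_Ck: "Ck 2 (\<lambda>x. a * f x)"
    and grad_scale: "grad (\<lambda>x. a * f x) x = a *\<^sub>R grad f x"
    and laplacian_scale: "laplacian (\<lambda>x. a * f x) x = a * laplacian f x"
  using C2_lincomb[OF f f, of a 0 0] by simp_all

lemma norm_grad_le_of_lipschitz:
  fixes g :: "real ^ 'n"
  assumes f: "(f has_derivative (\<lambda>h. g \<bullet> h)) (at x)"
    and L: "\<And>e. \<bar>f (x + e) - f x\<bar> \<le> L * norm e"
  shows "norm g \<le> L"
proof (cases "g = 0")
  case True
  have "0 \<le> \<bar>f (x + axis undefined 1) - f x\<bar>" by simp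
  also have "\<dots> \<le> L" using L[of "axis undefined 1"] by simp
  finally show ?thesis using True by simp
next
  case False
  have "((\<lambda>t. f (x + t *\<^sub>R g)) has_derivative (\<lambda>t. g \<bullet> (t *\<^sub>R g))) (at 0)"
  proof (rule has_derivative_compose[of _ "\<lambda>t. t *\<^sub>R g"])
    show "((\<lambda>t. x + t *\<^sub>R g) has_derivative (\<lambda>t. t *\<^sub>R g)) (at 0)"
      by (auto intro!: derivative_eq_intros)
  qed (use f in simp)
  moreover have "(\<lambda>t. g \<bullet> (t *\<^sub>R g)) = (*) (g \<bullet> g)" by auto
  ultimately have "((\<lambda>t. f (x + t *\<^sub>R g)) has_field_derivative g \<bullet> g) (at 0)"
    unfolding has_field_derivative_def by simp
  then have "((\<lambda>t. (f (x + t *\<^sub>R g) - f x) / t) \<longlongrightarrow> g \<bullet> g) (at 0)"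
    by (simp add: has_field_derivative_iff)
  then have "((\<lambda>t. \<bar>(f (x + t *\<^sub>R g) - f x) / t\<bar>) \<longlongrightarrow> \<bar>g \<bullet> g\<bar>) (at 0)"
    by (rule tendsto_rabs)
  moreover have "eventually (\<lambda>t. \<bar>(f (x + t *\<^sub>R g) - f x) / t\<bar> \<le> L * norm g) (at 0)"
    unfolding eventually_at_filter
  proof (intro always_eventually allI impI)
    fix t :: real assume "t \<noteq> 0"
    then show "\<bar>(f (x + t *\<^sub>R g) - f x) / t\<bar> \<le> L * norm g"
      using L[of "t *\<^sub>R g"] by (simp add: divide_simps mult_ac)
  qed
  ultimately have "\<bar>g \<bullet> g\<bar> \<le> L * norm g"
    by (intro tendsto_upperbound) auto
  then have "norm g * norm g \<le> L * norm g" by (simp add: dot_square_norm power2_eq_square)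
  with False show ?thesis by simp
qed

lemma lipschitz_of_norm_grad_le:
  fixes f :: "real ^ 'n \<Rightarrow> real"
  assumes f: "Ck 2 f" and L: "\<And>x. norm (grad f x) \<le> L"
  shows "\<bar>f y - f x\<bar> \<le> L * norm (y - x)"
proof -
  have "norm (f y - f x) \<le> L * norm (y - x)"
  proof (rule differentiable_bound[where S=UNIV and f'="\<lambda>x h. grad f x \<bullet> h"])
    show "onorm (\<lambda>h. grad f z \<bullet> h) \<le> L" for z
    proof (rule onorm_le)
      fix h have "norm (grad f z \<bullet> h) \<le> norm (grad f z) * norm h"
        by (simp add: Cauchy_Schwarz_ineq2)
      also have "\<dots> \<le> L * norm h" by (intro mult_right_mono L) auto
      finally show "norm (grad f z \<bullet> h) \<le> L * norm h" .
    qed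
  qed (use C2_has_derivative[OF f] in auto)
  then show ?thesis by simp
qed

section \<open>A smooth approximation of the norm\<close>

text \<open>
  A smooth convex substitute for the norm. It is the distance to the origin of the point
  \<open>(s, x)\<close> in one dimension more, so that it inherits the triangle inequality from the norm there.
\<close>

definition soft_norm :: "real \<Rightarrow> 'a::real_inner \<Rightarrow> real" where
  "soft_norm s x = sqrt (s\<^sup>2 + (norm x)\<^sup>2)"

lemma soft_norm_eq_norm: "soft_norm s x = norm (s, x)"
  by (simp add: soft_norm_def norm_Pair)

lemma soft_norm_pos: "s > 0 \<Longrightarrow> soft_norm s x > 0"
  by (simp add: soft_norm_def add_pos_nonneg)

lemma soft_norm_ge: "norm x \<le> soft_norm s x" "s \<le> soft_norm s x"
  by (auto simp: soft_norm_def intro: real_le_rsqrt)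

lemma soft_norm_lipschitz: "\<bar>soft_norm s x - soft_norm s y\<bar> \<le> norm (x - y)"
  unfolding soft_norm_eq_norm using norm_triangle_ineq3[of "(s, x)" "(s, y)"] by (simp add: norm_Pair)

lemma soft_norm_le: "s \<ge> 0 \<Longrightarrow> soft_norm s x \<le> s + norm x"
  unfolding soft_norm_eq_norm using norm_Pair_le[of s x] by simp

lemma has_derivative_soft_norm:
  assumes s: "s > 0"
  shows "((\<lambda>x. soft_norm s (x - a)) has_derivative
           (\<lambda>h. ((x - a) /\<^sub>R soft_norm s (x - a)) \<bullet> h)) (at x)"
proof -
  have p: "s\<^sup>2 + (x - a) \<bullet> (x - a) > 0" using s by (simp add: add_pos_nonneg)
  have eq: "soft_norm s x = sqrt (s\<^sup>2 + x \<bullet> x)" for x :: 'a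
    by (auto simp: soft_norm_def dot_square_norm)
  have "((\<lambda>x. sqrt (s\<^sup>2 + (x - a) \<bullet> (x - a))) has_derivative
      (\<lambda>h. (h \<bullet> (x - a) + (x - a) \<bullet> h) * (inverse (sqrt (s\<^sup>2 + (x - a) \<bullet> (x - a))) / 2))) (at x)"
    by (rule derivative_eq_intros p refl)+ (simp add: inner_commute)
  then show ?thesis
    unfolding eq by (simp add: inner_commute mult.commute)
qed

lemma soft_norm_C2:
  fixes a :: "real ^ 'n"
  assumes s: "s > 0"
  shows C2_soft_norm: "Ck 2 (\<lambda>x. soft_norm s (x - a))"
    and grad_soft_norm: "grad (\<lambda>x. soft_norm s (x - a)) x = (x - a) /\<^sub>R soft_norm s (x - a)"
    and laplacian_soft_norm_nonneg: "laplacian (\<lambda>x. soft_norm s (x - a)) x \<ge> 0"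
    and laplacian_soft_norm_le: "laplacian (\<lambda>x. soft_norm s (x - a)) x \<le> CARD('n) / s"
proof -
  let ?r = "\<lambda>x. soft_norm s (x - a)"
  let ?g = "\<lambda>x. (x - a) /\<^sub>R ?r x"
  let ?H = "\<lambda>i x. axis i 1 /\<^sub>R ?r x - ((x - a) $ i / (?r x)^3) *\<^sub>R (x - a)"
  note pos = soft_norm_pos[OF s]
  have nz: "?r x \<noteq> 0" for x using pos[of "x - a"] by simp
  have 1: "((\<lambda>x. ?r x) has_derivative (\<lambda>h. ?g x \<bullet> h)) (at x)" for x
    by (rule has_derivative_soft_norm[OF s])
  have 2: "((\<lambda>x. ?g x $ i) has_derivative (\<lambda>h. ?H i x \<bullet> h)) (at x)" for i x
  proof -
    have A: "?H i x \<bullet> h = h $ i / ?r x - (x - a) $ i / (?r x)^3 * ((x - a) \<bullet> h)" for h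
      by (simp add: inner_diff_left inner_axis' divide_inverse_commute)
    have B: "((\<lambda>x. (x - a) $ i / ?r x) has_derivative
        (\<lambda>h. (h $ i * ?r x - (x - a) $ i * (?g x \<bullet> h)) / (?r x * ?r x))) (at x)"
      by (rule derivative_eq_intros 1 nz refl bounded_linear.has_derivative[OF bounded_linear_vec_nth])+ simp
    have C: "(h $ i * ?r x - (x - a) $ i * (?g x \<bullet> h)) / (?r x * ?r x)
        = h $ i / ?r x - (x - a) $ i / (?r x)^3 * ((x - a) \<bullet> h)" for h
      unfolding inner_scaleR_left using nz[of x] by (simp add: field_simps power3_eq_cube)
    have D: "(\<lambda>x. ?g x $ i) = (\<lambda>x. (x - a) $ i / ?r x)"
      using nz by (intro ext) (simp add: field_simps)
    have E: "(\<lambda>h. ?H i x \<bullet> h) = (\<lambda>h. (h $ i * ?r x - (x - a) $ i * (?g x \<bullet> h)) / (?r x * ?r x))"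
      by (rule ext) (simp only: A C)
    have F: "((\<lambda>x. ?g x $ i) has_derivative (\<lambda>h. (h $ i * ?r x - (x - a) $ i * (?g x \<bullet> h)) / (?r x * ?r x))) (at x)"
      by (rule has_derivative_transform[OF _ _ B]) (simp_all only: UNIV_I D[THEN fun_cong])
    show ?thesis by (rule has_derivative_eq_rhs[OF F E[symmetric]])
  qed
  have cont: "continuous_on UNIV ?r"
    by (intro continuous_at_imp_continuous_on ballI has_derivative_continuous[OF 1])
  have 3: "continuous_on UNIV (?H i)" for i
    using nz by (auto intro!: continuous_intros cont)
  show "Ck 2 ?r" "grad ?r x = ?g x"
    by (fact C2_I[OF 1 2 3])+
  have lap: "laplacian ?r x = CARD('n) / ?r x - (norm (x - a))\<^sup>2 / (?r x)^3"
  proof -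
    have "?H i x $ i = 1 / ?r x - ((x - a) $ i * (x - a) $ i) / (?r x)^3" for i
      by (simp add: inverse_eq_divide)
    moreover have "(norm (x - a))\<^sup>2 = (\<Sum>i\<in>UNIV. (x - a) $ i * (x - a) $ i)"
      by (simp add: power2_norm_eq_inner inner_vec_def)
    ultimately show ?thesis
      unfolding C2_I_laplacian[OF 1 2 3] by (simp only: sum_subtractf sum_divide_distrib) simp
  qed
  have A: "(norm (x - a))\<^sup>2 \<le> (?r x)\<^sup>2" 
    using soft_norm_ge(1)[of "x - a" s] by (intro power_mono) auto
  then have "(norm (x - a))\<^sup>2 / (?r x)^3 \<le> (?r x)\<^sup>2 / (?r x)^3"
    using pos[of "x-a"] by (intro divide_right_mono) auto
  also have "\<dots> = 1 / ?r x" using nz by (simp add: power2_eq_square power3_eq_cube)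
  also have "\<dots> \<le> CARD('n) / ?r x" 
    using pos[of "x-a"] by (intro divide_right_mono) (auto simp: Suc_le_eq)
  finally show "laplacian ?r x \<ge> 0" unfolding lap by simp
  have "laplacian ?r x \<le> CARD('n) / ?r x" unfolding lap using pos[of "x-a"] by simp
  also have "\<dots> \<le> CARD('n) / s"
    using soft_norm_ge(2)[of s "x-a"] s by (intro divide_left_mono) auto
  finally show "laplacian ?r x \<le> CARD('n) / s" .
qed

text \<open>
  The gradient of \<^const>\<open>soft_norm\<close> varies at rate \<open>2 / s\<close> only: the parameter \<open>s\<close> is its radius of
  curvature. The next two lemmas state this for the gradient and for second differences.
\<close>

lemma normalized_soft_norm_lipschitz:
  fixes a b :: "'a::real_inner"
  assumes s: "s > 0"
  shows "norm (a /\<^sub>R soft_norm s a - b /\<^sub>R soft_norm s b) \<le> 2 / s * norm (a - b)"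
proof -
  let ?a = "soft_norm s a" and ?b = "soft_norm s b"
  have pa: "?a > 0" and pb: "?b > 0" using soft_norm_pos[OF s] by auto
  have "a /\<^sub>R ?a - b /\<^sub>R ?b = (a - b) /\<^sub>R ?a + ((?b - ?a) / (?a * ?b)) *\<^sub>R b"
  proof -
    have "(?b - ?a) / (?a * ?b) = inverse ?a - inverse ?b"
      using pa pb by (simp add: field_simps)
    then show ?thesis by (simp add: scaleR_diff_left scaleR_diff_right)
  qed
  also have "norm \<dots> \<le> norm ((a - b) /\<^sub>R ?a) + norm (((?b - ?a) / (?a * ?b)) *\<^sub>R b)"
    by (rule norm_triangle_ineq)
  also have "norm ((a - b) /\<^sub>R ?a) \<le> norm (a - b) / s"
    using soft_norm_ge(2)[of s a] s pa by (simp add: divide_simps mult_left_mono)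
  also have "norm (((?b - ?a) / (?a * ?b)) *\<^sub>R b) = (\<bar>?b - ?a\<bar> / ?a) * (norm b / ?b)"
    using pa pb by (simp add: abs_mult)
  also have "\<dots> \<le> (norm (a - b) / s) * 1"
  proof (intro mult_mono frac_le)
    show "\<bar>?b - ?a\<bar> \<le> norm (a - b)" using soft_norm_lipschitz[of s b a] by (simp add: norm_minus_commute)
    show "norm b / ?b \<le> 1" using soft_norm_ge(1)[of b s] pb by simp
  qed (use soft_norm_ge(2)[of s a] s pa pb in auto)
  finally show ?thesis by simp
qed

lemma soft_norm_second_difference:
  fixes x y e :: "real ^ 'n"
  assumes s: "s > 0"
  shows "\<bar>(soft_norm s (x + e) - soft_norm s x) - (soft_norm s (y + e) - soft_norm s y)\<bar>
     \<le> 2 / s * norm (x - y) * norm e"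
proof -
  define F where "F z = 1 * soft_norm s (z - 0) + (-1) * soft_norm s (z - (x - y)) + 0" for z
  note lin = C2_lincomb[OF C2_soft_norm[OF s, of 0] C2_soft_norm[OF s, of "x - y"], where a=1 and b="-1" and c=0,
    folded F_def]
  have "norm (grad F z) \<le> 2 / s * norm (x - y)" for z
    unfolding lin grad_soft_norm[OF s]
    using normalized_soft_norm_lipschitz[OF s, of "z - 0" "z - (x - y)"]
    by simp
  from lipschitz_of_norm_grad_le[OF lin(1) this, of "x + e" x]
  show ?thesis by (simp add: F_def algebra_simps)
qed

section \<open>Gaussian averages\<close>

text \<open>
  The density of the standard normal distribution on Euclidean space. It is the product of the
  one-dimensional densities of the coordinates, which gives its total mass.
\<close>

definition gauss :: "'a::euclidean_space \<Rightarrow> real" where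
  "gauss z = exp (- (norm z)\<^sup>2 / 2) / sqrt (2 * pi) ^ DIM('a)"

lemma gauss_pos: "gauss z > 0"
  by (simp add: gauss_def)

lemma gauss_nonneg[simp]: "gauss z \<ge> 0"
  using gauss_pos[of z] by simp

lemma gauss_borel_measurable[measurable]: "gauss \<in> borel_measurable borel"
  unfolding gauss_def by measurable

lemma gauss_eq_prod:
  "gauss (z :: 'a::euclidean_space) = (\<Prod>b\<in>Basis. std_normal_density (z \<bullet> b))"
proof -
  have "(norm z)\<^sup>2 = (\<Sum>b\<in>Basis. (z \<bullet> b)\<^sup>2)"
    unfolding power2_norm_eq_inner by (subst euclidean_inner) (simp add: power2_eq_square)
  then have "exp (- (norm z)\<^sup>2 / 2) = (\<Prod>b\<in>Basis. exp (- (z \<bullet> b)\<^sup>2 / 2))"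
    by (simp add: exp_sum[symmetric] sum_divide_distrib sum_negf)
  then show ?thesis
    by (simp add: gauss_def std_normal_density_def prod_dividef prod.distrib power_divide)
qed

lemma has_bochner_integral_gauss:
  "has_bochner_integral lborel (gauss :: 'a::euclidean_space \<Rightarrow> real) 1"
proof -
  interpret product_sigma_finite "\<lambda>_::'a. lborel :: real measure" ..
  let ?T = "\<lambda>f. \<Sum>b\<in>Basis. f b *\<^sub>R b :: 'a"
  have T[measurable]: "?T \<in> borel_measurable (\<Pi>\<^sub>M b\<in>Basis. lborel)" by measurable
  have comp: "gauss (?T f) = (\<Prod>b\<in>Basis. std_normal_density (f b))" for f
    by (simp add: gauss_eq_prod inner_sum_left inner_Basis if_distrib cong: if_cong)
  have "has_bochner_integral (\<Pi>\<^sub>M b\<in>Basis. lborel) (\<lambda>f. gauss (?T f)) 1"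
    unfolding comp has_bochner_integral_iff
    using product_integrable_prod[of Basis "\<lambda>_. std_normal_density"]
      product_integral_prod[of Basis "\<lambda>_. std_normal_density"] by simp
  then show ?thesis
    by (subst lborel_eq) (simp add: has_bochner_integral_distr T)
qed

lemma integrable_gauss: "integrable lborel (gauss :: 'a::euclidean_space \<Rightarrow> real)"
  and integral_gauss: "(\<integral>z. gauss z \<partial>lborel) = (1::real)"
  using has_bochner_integral_gauss by (auto simp: has_bochner_integral_iff)

lemma integrable_norm_gauss:
  "integrable lborel (\<lambda>z::'a::euclidean_space. norm z * gauss z)"
proof -
  have sc: "integrable lborel (\<lambda>z::'a. gauss ((1/2) *\<^sub>R z))"
  proof -
    have "integrable (density (distr lborel borel (\<lambda>x. 0 + 2 *\<^sub>R x)) (\<lambda>_. ennreal (\<bar>2\<bar>^DIM('a)))) (\<lambda>z::'a. gauss ((1/2) *\<^sub>R z))"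
      by (subst integrable_real_density) (auto simp: integrable_distr_eq integrable_gauss)
    then show ?thesis by (subst lborel_affine[of 2 0]) auto
  qed
  show ?thesis
  proof (rule Bochner_Integration.integrable_bound[OF integrable_mult_right[OF sc, of 4]])
    show "AE z in lborel. norm (norm z * gauss z) \<le> norm (4 * gauss ((1/2) *\<^sub>R (z::'a)))"
    proof (rule AE_I2)
      fix z :: 'a
      \<comment> \<open>Halving the argument turns the exponent \<open>1/2\<close> into \<open>1/8\<close>; the \<open>3/8\<close> left over absorb the factor \<open>norm z\<close>.\<close>
      have "4 * (1 + 3 * (norm z)\<^sup>2 / 8) - norm z = (norm z - 1)\<^sup>2 / 2 + (norm z)\<^sup>2 + 7 / 2"
        by (simp add: power2_eq_square field_simps)
      also have "\<dots> \<ge> 0" by (intro add_nonneg_nonneg) auto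
      finally have "norm z \<le> 4 * (1 + 3 * (norm z)\<^sup>2 / 8)" by simp
      also have "\<dots> \<le> 4 * exp (3 * (norm z)\<^sup>2 / 8)"
        by (intro mult_left_mono) auto
      finally have "norm z * exp (- (norm z)\<^sup>2 / 2) \<le> 4 * exp (3 * (norm z)\<^sup>2 / 8) * exp (- (norm z)\<^sup>2 / 2)"
        by (intro mult_right_mono) auto
      also have "\<dots> = 4 * exp (- ((norm z)\<^sup>2 / 4) / 2)"
        by (simp add: exp_add[symmetric] field_simps)
      finally show "norm (norm z * gauss z) \<le> norm (4 * gauss ((1/2) *\<^sub>R z))"
        by (simp add: gauss_def divide_right_mono power_divide)
    qed
  qed auto
qed

text \<open>
  The heat kernel, parametrized by the standard deviation \<open>s\<close> (time is \<open>s\<^sup>2 / 2\<close>), so that only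
  integer powers of the parameter occur; the heat equation then reads \<open>\<partial>\<^sub>s heat = s \<Delta> heat\<close>.
\<close>

definition heat :: "real \<Rightarrow> 'a::euclidean_space \<Rightarrow> real" where
  "heat s z = gauss (z /\<^sub>R s) / s ^ DIM('a)"

text \<open>
  The heat semigroup, written as a Gaussian average over displacements. In this form translations
  act on \<open>p\<close> alone, which is what the bounds below use; the convolution form is needed to differentiate.
\<close>
definition heat_mean :: "real \<Rightarrow> ('a::euclidean_space \<Rightarrow> real) \<Rightarrow> 'a \<Rightarrow> real" where
  "heat_mean s p x = (\<integral>z. p (x + s *\<^sub>R z) * gauss z \<partial>lborel)"

lemma integral_mult_heat:
  fixes p :: "'a::euclidean_space \<Rightarrow> real"
  assumes s: "s > 0" and [measurable]: "p \<in> borel_measurable borel"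
  shows "(\<integral>y. p y * heat s (x - y) \<partial>lborel) = heat_mean s p x"
proof -
  have even: "gauss (- z) = gauss z" for z :: 'a by (simp add: gauss_def)
  have "(\<integral>y. p y * heat s (x - y) \<partial>lborel) =
      (\<integral>y. p y * heat s (x - y) \<partial>(density (distr lborel borel (\<lambda>z. x + s *\<^sub>R z)) (\<lambda>_. ennreal (\<bar>s\<bar>^DIM('a)))))"
    using lborel_affine[of s x] s by simp
  also have "\<dots> = (\<integral>z. s ^ DIM('a) * (p (x + s *\<^sub>R z) * heat s (- (s *\<^sub>R z))) \<partial>lborel)"
    using s by (subst integral_real_density) (auto simp: integral_distr heat_def)
  also have "\<dots> = heat_mean s p x"
    unfolding heat_mean_def
    using s by (intro Bochner_Integration.integral_cong) (auto simp: heat_def even)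
  finally show ?thesis .
qed

lemma integrable_mult_gauss:
  fixes p :: "'a::euclidean_space \<Rightarrow> real"
  assumes [measurable]: "p \<in> borel_measurable borel" and B: "\<And>x. \<bar>p x\<bar> \<le> B"
  shows "integrable lborel (\<lambda>z. p (x + s *\<^sub>R z) * gauss z)"
proof (rule Bochner_Integration.integrable_bound[OF integrable_mult_right[OF integrable_gauss, of B]])
  show "AE z in lborel. norm (p (x + s *\<^sub>R z) * gauss z) \<le> norm (B * gauss z)"
    using B order_trans[OF abs_ge_zero B] by (auto simp: abs_mult intro!: mult_right_mono order_trans[OF B])
qed auto

lemma heat_mean_nonneg:
  assumes "\<And>x. p x \<ge> 0" shows "heat_mean s p x \<ge> 0"
  unfolding heat_mean_def using assms by (intro Bochner_Integration.integral_nonneg) auto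

lemma heat_mean_le:
  fixes p :: "'a::euclidean_space \<Rightarrow> real"
  assumes [measurable]: "p \<in> borel_measurable borel" and B: "\<And>x. \<bar>p x\<bar> \<le> B"
  shows "heat_mean s p x \<le> B"
proof -
  have "heat_mean s p x \<le> (\<integral>z. B * gauss (z::'a) \<partial>lborel)"
    unfolding heat_mean_def
    using B by (intro integral_mono integrable_mult_gauss[OF _ B] integrable_mult_right integrable_gauss)
       (auto intro!: mult_right_mono order_trans[OF abs_ge_self B])
  then show ?thesis by (simp add: integral_gauss)
qed

lemma heat_mean_close:
  fixes p :: "'a::euclidean_space \<Rightarrow> real"
  assumes s: "s \<ge> 0" and [measurable]: "p \<in> borel_measurable borel" and B: "\<And>x. \<bar>p x\<bar> \<le> B"
    and L: "\<And>x y. \<bar>p x - p y\<bar> \<le> L * norm (x - y)"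
  shows "\<bar>heat_mean s p x - p x\<bar> \<le> L * s * (\<integral>z. norm (z::'a) * gauss z \<partial>lborel)"
proof -
  have i: "integrable lborel (\<lambda>z. p (x + s *\<^sub>R z) * gauss z)"
    by (rule integrable_mult_gauss[OF _ B]) auto
  have "heat_mean s p x - p x = (\<integral>z. p (x + s *\<^sub>R z) * gauss z - p x * gauss z \<partial>lborel)"
    unfolding heat_mean_def
    by (simp add: Bochner_Integration.integral_diff i integrable_gauss integral_gauss)
  also have "\<bar>\<dots>\<bar> \<le> (\<integral>z. L * s * (norm (z::'a) * gauss z) \<partial>lborel)"
  proof (rule Bochner_Integration.integral_abs_bound_integral)
    show "\<bar>p (x + s *\<^sub>R z) * gauss z - p x * gauss z\<bar> \<le> L * s * (norm z * gauss z)" for z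
    proof -
      have "\<bar>p (x + s *\<^sub>R z) * gauss z - p x * gauss z\<bar> = \<bar>p (x + s *\<^sub>R z) - p x\<bar> * gauss z"
        by (simp add: left_diff_distrib[symmetric] abs_mult)
      also have "\<dots> \<le> L * norm (s *\<^sub>R z) * gauss z"
        using L[of "x + s *\<^sub>R z" x] by (intro mult_right_mono) auto
      finally show ?thesis using s by (simp add: mult_ac)
    qed
  qed (auto intro!: i integrable_gauss integrable_norm_gauss integrable_mult_right)
  finally show ?thesis by simp
qed

text \<open>
  Here \<open>p + w\<close> is 1-Lipschitz but only \<open>p\<close> is averaged. Averaging \<open>p + w\<close> would preserve the Lipschitz
  constant; the difference is how much an increment of \<open>w\<close> changes from \<open>x\<close> to the displaced point,
  and this is small when the gradient of \<open>w\<close> varies slowly.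
\<close>
lemma heat_mean_increment:
  fixes p w :: "'a::euclidean_space \<Rightarrow> real"
  assumes s: "s \<ge> 0" and [measurable]: "p \<in> borel_measurable borel" and B: "\<And>x. \<bar>p x\<bar> \<le> B"
    and v: "\<And>x. \<bar>(p (x + e) + w (x + e)) - (p x + w x)\<bar> \<le> norm e"
    and w: "\<And>x y. \<bar>(w (x + e) - w x) - (w (y + e) - w y)\<bar> \<le> D * norm (x - y) * norm e"
  shows "\<bar>(heat_mean s p (x + e) - heat_mean s p x) + (w (x + e) - w x)\<bar>
    \<le> norm e * (1 + D * s * (\<integral>z. norm (z::'a) * gauss z \<partial>lborel))"
proof -
  have i: "integrable lborel (\<lambda>z. p (y + s *\<^sub>R z) * gauss z)" for y
    by (rule integrable_mult_gauss[OF _ B]) auto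
  have "(heat_mean s p (x + e) - heat_mean s p x) + (w (x + e) - w x) =
     (\<integral>z. (p (x + e + s *\<^sub>R z) * gauss z - p (x + s *\<^sub>R z) * gauss z) + (w (x + e) - w x) * gauss z \<partial>lborel)"
    unfolding heat_mean_def
    by (simp add: Bochner_Integration.integral_diff Bochner_Integration.integral_add i integrable_gauss integral_gauss)
  also have "\<bar>\<dots>\<bar> \<le> (\<integral>z. norm e * gauss (z::'a) + D * s * norm e * (norm z * gauss z) \<partial>lborel)"
  proof (rule Bochner_Integration.integral_abs_bound_integral)
    fix z :: 'a
    define y where "y = x + s *\<^sub>R z"
    have "\<bar>(p (y + e) - p y) + (w (x + e) - w x)\<bar> \<le> norm e + D * norm (x - y) * norm e"
      using v[of y] w[of x y] by linarith
    also have "norm (x - y) = s * norm z" using s by (simp add: y_def)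
    finally have "\<bar>(p (y + e) - p y) + (w (x + e) - w x)\<bar> * gauss z \<le> (norm e + D * (s * norm z) * norm e) * gauss z"
      by (intro mult_right_mono) auto
    also have "\<bar>(p (y + e) - p y) + (w (x + e) - w x)\<bar> * gauss z =
      \<bar>((p (y + e) - p y) + (w (x + e) - w x)) * gauss z\<bar>" by (simp add: abs_mult)
    also have "((p (y + e) - p y) + (w (x + e) - w x)) * gauss z =
      (p (x + e + s *\<^sub>R z) * gauss z - p (x + s *\<^sub>R z) * gauss z) + (w (x + e) - w x) * gauss z"
      by (simp add: y_def algebra_simps)
    finally show "\<bar>(p (x + e + s *\<^sub>R z) * gauss z - p (x + s *\<^sub>R z) * gauss z) + (w (x + e) - w x) * gauss z\<bar>
       \<le> norm e * gauss z + D * s * norm e * (norm z * gauss z)"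
      by (simp add: algebra_simps)
  qed (auto intro!: i integrable_gauss integrable_norm_gauss integrable_mult_right)
  also have "\<dots> = norm e * (1 + D * s * (\<integral>z. norm (z::'a) * gauss z \<partial>lborel))"
    by (subst Bochner_Integration.integral_add)
       (auto simp: integrable_gauss integrable_norm_gauss integral_gauss distrib_left)
  finally show ?thesis .
qed

section \<open>Derivatives of the heat kernel\<close>

text \<open>
  The Leibniz rule with the derivatives represented by gradients instead of bounded linear maps.
\<close>

lemma has_derivative_integral_cbox:
  fixes F :: "real ^ 'n \<Rightarrow> 'b::euclidean_space \<Rightarrow> real"
  assumes F: "\<And>x y. y \<in> cbox a b \<Longrightarrow> ((\<lambda>x. F x y) has_derivative (\<lambda>h. D x y \<bullet> h)) (at x)"
    and cF: "\<And>x. continuous_on (cbox a b) (F x)"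
    and cD: "continuous_on (UNIV \<times> cbox a b) (\<lambda>(x, y). D x y)"
  shows "((\<lambda>x. integral (cbox a b) (F x)) has_derivative (\<lambda>h. integral (cbox a b) (D x) \<bullet> h)) (at x)"
proof -
  have int: "D x integrable_on cbox a b"
  proof (rule integrable_continuous)
    show "continuous_on (cbox a b) (D x)"
    proof -
      have "continuous_on (cbox a b) (\<lambda>y. (\<lambda>(x, y). D x y) (x, y))"
        by (rule continuous_on_compose2[OF cD]) (auto intro!: continuous_intros)
      then show ?thesis by simp
    qed
  qed
  have "((\<lambda>x. integral (cbox a b) (F x)) has_derivative
      blinfun_apply (integral (cbox a b) (\<lambda>y. blinfun_inner_right (D x y)))) (at x within UNIV)"
  proof (rule leibniz_rule)
    show "continuous_on (UNIV \<times> cbox a b) (\<lambda>(x, y). blinfun_inner_right (D x y))"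
      using cD by (auto simp: split_beta intro!: continuous_intros bounded_linear.continuous_on[OF bounded_linear_blinfun_inner_right])
  qed (use F cF in \<open>auto intro!: integrable_continuous simp: has_derivative_at_withinI\<close>)
  also have "integral (cbox a b) (\<lambda>y. blinfun_inner_right (D x y)) = blinfun_inner_right (integral (cbox a b) (D x))"
    using integral_linear[OF int bounded_linear_blinfun_inner_right] by (simp add: o_def)
  finally show ?thesis by simp
qed

text \<open>
  The \<open>i\<close>-th row of the Hessian of the heat kernel.
\<close>

definition heat_hess :: "real \<Rightarrow> 'n \<Rightarrow> real ^ 'n \<Rightarrow> real ^ 'n" where
  "heat_hess s i z = heat s z *\<^sub>R ((z $ i / s ^ 4) *\<^sub>R z - (1 / s\<^sup>2) *\<^sub>R axis i 1)"

lemma heat_eq: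
  "s > 0 \<Longrightarrow> heat s (z :: real ^ 'n) = exp (- (z \<bullet> z) / (2 * s\<^sup>2)) / (sqrt (2 * pi) ^ CARD('n) * s ^ CARD('n))"
  by (simp add: heat_def gauss_def power_mult_distrib dot_square_norm power_divide divide_simps)

lemma has_derivative_heat:
  fixes z :: "real ^ 'n"
  assumes s: "s > 0"
  shows "(heat s has_derivative (\<lambda>h. (- (heat s z / s\<^sup>2) *\<^sub>R z) \<bullet> h)) (at z)"
proof -
  have eq: "heat s = (\<lambda>z :: real ^ 'n. exp (- (z \<bullet> z) / (2 * s\<^sup>2)) / (sqrt (2 * pi) ^ CARD('n) * s ^ CARD('n)))"
    using heat_eq[OF s] by auto
  have "((\<lambda>z :: real ^ 'n. exp (- (z \<bullet> z) / (2 * s\<^sup>2)) / (sqrt (2 * pi) ^ CARD('n) * s ^ CARD('n))) has_derivative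
     (\<lambda>h. exp (- (z \<bullet> z) / (2 * s\<^sup>2)) * (- (2 * (z \<bullet> h)) / (2 * s\<^sup>2)) / (sqrt (2 * pi) ^ CARD('n) * s ^ CARD('n)))) (at z)"
    using s by (auto intro!: derivative_eq_intros simp: inner_commute fun_eq_iff field_simps power2_eq_square power4_eq_xxxx)
  then show ?thesis
    unfolding eq by (rule has_derivative_eq_rhs) (simp add: fun_eq_iff)
qed

lemma has_derivative_heat_grad:
  fixes z :: "real ^ 'n"
  assumes s: "s > 0"
  shows "((\<lambda>z. - (heat s z / s\<^sup>2) * z $ i) has_derivative (\<lambda>h. heat_hess s i z \<bullet> h)) (at z)"
proof -
  have "((\<lambda>z. - (heat s z / s\<^sup>2) * z $ i) has_derivative
      (\<lambda>h. - (heat s z / s\<^sup>2) * h $ i + - (((- (heat s z / s\<^sup>2) *\<^sub>R z) \<bullet> h) / s\<^sup>2) * z $ i)) (at z)"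
    using s by (auto intro!: derivative_eq_intros has_derivative_heat bounded_linear.has_derivative[OF bounded_linear_vec_nth]
        simp: fun_eq_iff field_simps power2_eq_square power4_eq_xxxx)
  moreover have "- (heat s z / s\<^sup>2) * h $ i + - (((- (heat s z / s\<^sup>2) *\<^sub>R z) \<bullet> h) / s\<^sup>2) * z $ i = heat_hess s i z \<bullet> h" for h
    using s unfolding heat_hess_def inner_scaleR_left inner_diff_left inner_axis'
    by (simp add: field_simps)
  ultimately show ?thesis by simp
qed

text \<open>
  The heat equation: the sum on the right is the Laplacian of the kernel.
\<close>

lemma has_field_derivative_heat_scale:
  fixes z :: "real ^ 'n"
  assumes s: "s > 0"
  shows "((\<lambda>s. heat s z) has_field_derivative s * (\<Sum>i\<in>UNIV. heat_hess s i z $ i)) (at s)"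
proof -
  let ?n = "CARD('n)"
  let ?c = "sqrt (2 * pi) ^ ?n"
  have lap: "(\<Sum>i\<in>UNIV. heat_hess s i z $ i) = heat s z * ((z \<bullet> z) / s ^ 4 - ?n / s\<^sup>2)"
    by (simp add: heat_hess_def sum_distrib_left[symmetric] sum_subtractf inner_vec_def sum_divide_distrib)
  have "((\<lambda>s. exp (- (z \<bullet> z) / (2 * s\<^sup>2)) / (?c * s ^ ?n)) has_field_derivative
      exp (- (z \<bullet> z) / (2 * s\<^sup>2)) / (?c * s ^ ?n) * ((z \<bullet> z) / s ^ 3 - ?n / s)) (at s)"
    using s
    by (auto intro!: derivative_eq_intros simp: field_simps power3_eq_cube power4_eq_xxxx power_eq_if[of s "CARD('n)"])
  then have "((\<lambda>s. exp (- (z \<bullet> z) / (2 * s\<^sup>2)) / (?c * s ^ ?n)) has_field_derivative s * (\<Sum>i\<in>UNIV. heat_hess s i z $ i)) (at s)"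
    unfolding lap heat_eq[OF s]
  proof (rule DERIV_cong)
    have e: "s * s ^ 3 = s ^ 4" by (simp add: power3_eq_cube power4_eq_xxxx)
    have "(z \<bullet> z) / s ^ 3 - ?n / s = s * ((z \<bullet> z) / s ^ 4 - ?n / s\<^sup>2)"
      using s by (simp add: right_diff_distrib e[symmetric] power2_eq_square)
    then show "X * ((z \<bullet> z) / s ^ 3 - ?n / s) = s * (X * ((z \<bullet> z) / s ^ 4 - ?n / s\<^sup>2))" for X
      by (simp only: mult.left_commute)
  qed
  then show ?thesis
  proof (rule has_field_derivative_transform_within_open[of _ _ _ "{0<..}"])
  qed (use s in \<open>auto simp: heat_eq\<close>)
qed

lemma continuous_on_heat[continuous_intros]:
  fixes g :: "'b::topological_space \<Rightarrow> real ^ 'n"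
  assumes "continuous_on S f" "continuous_on S g" "\<And>x. x \<in> S \<Longrightarrow> f x > 0"
  shows "continuous_on S (\<lambda>x. heat (f x) (g x))"
proof -
  have nz: "f x \<noteq> 0" if "x \<in> S" for x using assms(3)[OF that] by simp
  have "continuous_on S (\<lambda>x. exp (- (g x \<bullet> g x) / (2 * (f x)\<^sup>2)) / (sqrt (2 * pi) ^ CARD('n) * f x ^ CARD('n)))"
    by (auto intro!: continuous_intros assms(1,2) dest: nz)
  then show ?thesis using assms(3) by (simp add: heat_eq cong: continuous_on_cong)
qed

lemma continuous_on_heat_hess[continuous_intros]:
  fixes g :: "'b::topological_space \<Rightarrow> real ^ 'n"
  assumes "continuous_on S f" "continuous_on S g" "\<And>x. x \<in> S \<Longrightarrow> f x > 0"
  shows "continuous_on S (\<lambda>x. heat_hess (f x) i (g x))"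
proof -
  have nz: "f x \<noteq> 0" if "x \<in> S" for x using assms(3)[OF that] by simp
  show ?thesis
    unfolding heat_hess_def by (auto intro!: continuous_intros assms dest: nz)
qed

lemma integral_cbox_mult_heat:
  fixes p :: "real ^ 'n \<Rightarrow> real"
  assumes s: "s > 0" and p: "continuous_on UNIV p" and supp: "\<And>y. y \<notin> cbox a b \<Longrightarrow> p y = 0"
  shows "integral (cbox a b) (\<lambda>y. p y * heat s (x - y)) = heat_mean s p x"
proof -
  let ?f = "\<lambda>y. p y * heat s (x - y)"
  have [measurable]: "p \<in> borel_measurable borel"
    using p by (rule borel_measurable_continuous_onI)
  have "continuous_on (cbox a b) ?f"
    using s by (auto intro!: continuous_intros continuous_on_subset[OF p])
  then have "integrable lborel (\<lambda>y. indicator (cbox a b) y *\<^sub>R ?f y)"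
    by (intro borel_integrable_compact) auto
  then have "set_integrable lborel (cbox a b) ?f" by (simp add: set_integrable_def)
  then have "integral (cbox a b) ?f = (LINT y:cbox a b|lborel. ?f y)"
    by (rule set_borel_integral_eq_integral(2)[symmetric])
  also have "\<dots> = (\<integral>y. ?f y \<partial>lborel)"
    unfolding set_lebesgue_integral_def using supp
    by (intro Bochner_Integration.integral_cong) (auto simp: indicator_def)
  also have "\<dots> = heat_mean s p x" by (rule integral_mult_heat[OF s]) simp
  finally show ?thesis .
qed

section \<open>The resolvent of the Laplacian\<close>

text \<open>
  The exponential law with mean \<open>h\<close> of the time \<open>t = s\<^sup>2 / 2\<close>, as a density in the variable \<open>s\<close>.
\<close>

definition time_weight :: "real \<Rightarrow> real \<Rightarrow> real" where
  "time_weight h s = s / h * exp (- s\<^sup>2 / (2 * h))"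

text \<open>
  The resolvent \<open>(1 - h \<Delta>)\<^sup>-\<^sup>1 p\<close> is the Laplace transform in time of the heat semigroup. Cutting
  the range of times down to \<open>\<tau> \<le> s \<le> T\<close> avoids the singularity of the kernel at time 0 and
  the infinite range, and for \<open>p\<close> supported in \<open>cbox a b\<close> leaves the integral of a continuous function over one
  compact box. It is then as smooth as the kernel, even for a merely continuous \<open>p\<close>.
\<close>

definition resolvent ::
  "real \<Rightarrow> real \<Rightarrow> real \<Rightarrow> real ^ 'n \<Rightarrow> real ^ 'n \<Rightarrow> (real ^ 'n \<Rightarrow> real) \<Rightarrow> real ^ 'n \<Rightarrow> real" where
  "resolvent h \<tau> T a b p x =
     integral (cbox (a, \<tau>) (b, T)) (\<lambda>y. time_weight h (snd y) * p (fst y) * heat (snd y) (x - fst y))"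

lemma continuous_on_time_weight[continuous_intros]:
  "continuous_on S f \<Longrightarrow> continuous_on S (\<lambda>x. time_weight h (f x))"
  unfolding time_weight_def divide_inverse by (intro continuous_intros)

lemma time_weight_nonneg: "h > 0 \<Longrightarrow> s \<ge> 0 \<Longrightarrow> time_weight h s \<ge> 0"
  by (simp add: time_weight_def)

lemma has_integral_time_weight:
  assumes h: "h > 0" and "\<tau> \<le> T"
  shows "(time_weight h has_integral exp (- \<tau>\<^sup>2 / (2 * h)) - exp (- T\<^sup>2 / (2 * h))) {\<tau>..T}"
proof -
  have "(time_weight h has_integral (- exp (- T\<^sup>2 / (2 * h))) - (- exp (- \<tau>\<^sup>2 / (2 * h)))) {\<tau>..T}"
  proof (rule fundamental_theorem_of_calculus[OF \<open>\<tau> \<le> T\<close>])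
    fix s
    have "((\<lambda>s. - exp (- s\<^sup>2 / (2 * h))) has_field_derivative time_weight h s) (at s within {\<tau>..T})"
      using h by (auto intro!: derivative_eq_intros simp: time_weight_def)
    then show "((\<lambda>s. - exp (- s\<^sup>2 / (2 * h))) has_vector_derivative time_weight h s) (at s within {\<tau>..T})"
      by (simp add: has_real_derivative_iff_has_vector_derivative)
  qed
  then show ?thesis by (simp add: algebra_simps)
qed

text \<open>
  The mean of \<open>s\<close> under the time weight stays bounded as \<open>h\<close> varies in \<open>(0, 1]\<close>. Estimating \<open>s\<close> by \<open>1 + s\<^sup>2\<close>
  gives an integrand with an elementary antiderivative.
\<close>

lemma integral_time_weight_mult_le:
  assumes h: "h > 0" "h \<le> 1" and \<tau>: "0 < \<tau>" "\<tau> \<le> 1" "\<tau> \<le> T"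
  shows "integral {\<tau>..T} (\<lambda>s. time_weight h s * s) \<le> 4"
proof -
  let ?E = "\<lambda>s. - exp (- s\<^sup>2 / (2 * h)) * (s\<^sup>2 + 1 + 2 * h)"
  have I: "((\<lambda>s. time_weight h s * (1 + s\<^sup>2)) has_integral ?E T - ?E \<tau>) {\<tau>..T}"
  proof (rule fundamental_theorem_of_calculus[OF \<open>\<tau> \<le> T\<close>])
    fix s
    have "(?E has_field_derivative time_weight h s * (1 + s\<^sup>2)) (at s within {\<tau>..T})"
      using h by (auto intro!: derivative_eq_intros simp: time_weight_def field_simps)
    then show "(?E has_vector_derivative time_weight h s * (1 + s\<^sup>2)) (at s within {\<tau>..T})"
      by (simp add: has_real_derivative_iff_has_vector_derivative)
  qed
  have "integral {\<tau>..T} (\<lambda>s. time_weight h s * s) \<le> integral {\<tau>..T} (\<lambda>s. time_weight h s * (1 + s\<^sup>2))"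
  proof (rule integral_le)
    fix s assume "s \<in> {\<tau>..T}"
    moreover have "s \<le> 1 + s\<^sup>2"
    proof -
      have "1 + s\<^sup>2 - s = (s - 1 / 2)\<^sup>2 + 3 / 4" by (simp add: power2_eq_square field_simps)
      also have "\<dots> \<ge> 0" by (intro add_nonneg_nonneg) auto
      finally show ?thesis by simp
    qed
    ultimately show "time_weight h s * s \<le> time_weight h s * (1 + s\<^sup>2)"
      using h \<tau> by (intro mult_left_mono time_weight_nonneg) auto
  qed (use I in \<open>auto intro!: integrable_continuous_interval continuous_intros\<close>)
  also have "\<dots> = ?E T - ?E \<tau>" using I by (rule integral_unique)
  also have "\<dots> \<le> exp (- \<tau>\<^sup>2 / (2 * h)) * (\<tau>\<^sup>2 + 1 + 2 * h)"
    using h by simp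
  also have "\<dots> \<le> 1 * 4"
    using h \<tau> power_le_one[of \<tau> 2] by (intro mult_mono) auto
  finally show ?thesis by simp
qed

context
  fixes h \<tau> T :: real and a b :: "real ^ 'n" and p :: "real ^ 'n \<Rightarrow> real"
  assumes h: "h > 0" and \<tau>: "0 < \<tau>" "\<tau> \<le> T"
    and p: "continuous_on UNIV p" and supp: "\<And>y. y \<notin> cbox a b \<Longrightarrow> p y = 0"
begin

lemma resolvent_C2:
  shows C2_resolvent: "Ck 2 (resolvent h \<tau> T a b p)"
    and laplacian_resolvent: "laplacian (resolvent h \<tau> T a b p) x =
      integral (cbox (a, \<tau>) (b, T)) (\<lambda>y. time_weight h (snd y) * p (fst y) * (\<Sum>i\<in>UNIV. heat_hess (snd y) i (x - fst y) $ i))"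
proof -
  let ?B = "cbox (a, \<tau>) (b, T)"
  have pos: "snd y > 0" if "y \<in> ?B" for y using that \<tau> by (cases y) auto
  note cp = continuous_on_compose2[OF p _ subset_UNIV]
  let ?c = "\<lambda>y. time_weight h (snd y) * p (fst y)"
  let ?F = "\<lambda>x y. ?c y * heat (snd y) (x - fst y)"
  let ?G = "\<lambda>x y. ?c y *\<^sub>R (- (heat (snd y) (x - fst y) / (snd y)\<^sup>2) *\<^sub>R (x - fst y))"
  let ?H = "\<lambda>i x y. ?c y *\<^sub>R heat_hess (snd y) i (x - fst y)"
  have dF: "((\<lambda>x. ?F x y) has_derivative (\<lambda>h. ?G x y \<bullet> h)) (at x)" if "y \<in> ?B" for x y
  proof -
    have "((\<lambda>x. heat (snd y) (x - fst y)) has_derivative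
       (\<lambda>h. (- (heat (snd y) (x - fst y) / (snd y)\<^sup>2) *\<^sub>R (x - fst y)) \<bullet> h)) (at x)"
      by (rule has_derivative_compose[OF _ has_derivative_heat[OF pos[OF that]], of "\<lambda>x. x - fst y" "\<lambda>h. h"])
         (auto intro!: derivative_eq_intros)
    from has_derivative_mult_right[OF this, of "?c y"]
    show ?thesis by (simp only: inner_scaleR_left)
  qed
  have dG: "((\<lambda>x. ?G x y $ i) has_derivative (\<lambda>h. ?H i x y \<bullet> h)) (at x)" if "y \<in> ?B" for x y i
  proof -
    have "((\<lambda>x. - (heat (snd y) (x - fst y) / (snd y)\<^sup>2) * (x - fst y) $ i) has_derivative
       (\<lambda>h. heat_hess (snd y) i (x - fst y) \<bullet> h)) (at x)"
      by (rule has_derivative_compose[OF _ has_derivative_heat_grad[OF pos[OF that]], of "\<lambda>x. x - fst y" "\<lambda>h. h"])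
         (auto intro!: derivative_eq_intros)
    from has_derivative_mult_right[OF this, of "?c y"]
    show ?thesis by (simp only: inner_scaleR_left vector_scaleR_component real_scaleR_def)
  qed
  have cF: "continuous_on ?B (?F x)" for x
    by (intro continuous_intros cp pos) auto
  have cG: "continuous_on (UNIV \<times> ?B) (\<lambda>(x, y). ?G x y)"
    unfolding split_beta
    by (intro continuous_intros cp pos) (use \<tau> in \<open>auto dest: pos\<close>)
  have cG1: "continuous_on ?B (?G x)" for x
    by (intro continuous_intros cp pos) (use \<tau> in \<open>auto dest: pos\<close>)
  have cH: "continuous_on (UNIV \<times> ?B) (\<lambda>(x, y). ?H i x y)" for i
    unfolding split_beta
    by (intro continuous_intros cp pos) (use \<tau> in \<open>auto dest: pos\<close>)
  have cH1: "continuous_on ?B (?H i x)" for x i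
    by (intro continuous_intros cp pos) (use \<tau> in \<open>auto dest: pos\<close>)
  let ?q = "resolvent h \<tau> T a b p"
  have 1: "(?q has_derivative (\<lambda>h. integral ?B (?G x) \<bullet> h)) (at x)" for x
    using has_derivative_integral_cbox[OF dF cF cG] unfolding resolvent_def[abs_def] .
  have G: "integral ?B (?G x) $ i = integral ?B (\<lambda>y. ?G x y $ i)" for x i
    using integral_linear[OF integrable_continuous[OF cG1] bounded_linear_vec_nth, of i x] by (simp add: o_def)
  have "((\<lambda>x. integral ?B (\<lambda>y. ?G x y $ i)) has_derivative (\<lambda>h. integral ?B (?H i x) \<bullet> h)) (at x)" for i x
    by (rule has_derivative_integral_cbox[OF dG _ cH]) (assumption, intro continuous_intros cG1)
  then have 2: "((\<lambda>x. integral ?B (?G x) $ i) has_derivative (\<lambda>h. integral ?B (?H i x) \<bullet> h)) (at x)" for i x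
    by (simp only: G)
  have 3: "continuous_on UNIV (\<lambda>x. integral ?B (?H i x))" for i
    by (rule integral_continuous_on_param[OF cH])
  show "Ck 2 ?q" by (rule C2_I_Ck[OF 1 2 3])
  have "integral ?B (?H i x) $ i = integral ?B (\<lambda>y. ?H i x y $ i)" for i
    using integral_linear[OF integrable_continuous[OF cH1] bounded_linear_vec_nth, of i i x] by (simp add: o_def)
  then have "laplacian ?q x = (\<Sum>i\<in>UNIV. integral ?B (\<lambda>y. ?H i x y $ i))"
    by (simp add: C2_I_laplacian[OF 1 2 3])
  also have "\<dots> = integral ?B (\<lambda>y. \<Sum>i\<in>UNIV. ?H i x y $ i)"
    by (rule integral_sum[symmetric]) (simp, intro integrable_continuous continuous_on_component cH1)
  also have "\<dots> = integral ?B (\<lambda>y. ?c y * (\<Sum>i\<in>UNIV. heat_hess (snd y) i (x - fst y) $ i))"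
    by (simp add: sum_distrib_left)
  finally show "laplacian ?q x = \<dots>" .
qed

text \<open>
  Integrating the heat equation by parts in \<open>s\<close> leaves the two ends of the time range. For \<open>\<tau> \<rightarrow> 0\<close> and
  \<open>T \<rightarrow> \<infinity>\<close> the right-hand side tends to \<open>p x\<close>; \<open>resolvent_error\<close> below makes this quantitative.
\<close>

lemma resolvent_equation:
  "resolvent h \<tau> T a b p x - h * laplacian (resolvent h \<tau> T a b p) x
    = exp (- \<tau>\<^sup>2 / (2 * h)) * heat_mean \<tau> p x - exp (- T\<^sup>2 / (2 * h)) * heat_mean T p x"
proof -
  let ?B = "cbox (a, \<tau>) (b, T)"
  let ?L = "\<lambda>s z. \<Sum>i\<in>UNIV. heat_hess s i (z :: real ^ 'n) $ i"
  let ?E = "\<lambda>s. exp (- s\<^sup>2 / (2 * h))"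
  have pos: "snd y > 0" if "y \<in> ?B" for y using that \<tau> by (cases y) auto
  note cp = continuous_on_compose2[OF p _ subset_UNIV]
  define F where "F y s = p y * (time_weight h s * heat s (x - y) - s * ?E s * ?L s (x - y))" for y s
  have cF: "continuous_on ?B (\<lambda>(y, s). F y s)"
    unfolding F_def split_beta using h
    by (intro continuous_intros cp pos) auto
  have "resolvent h \<tau> T a b p x - h * laplacian (resolvent h \<tau> T a b p) x =
    integral ?B (\<lambda>y. time_weight h (snd y) * p (fst y) * heat (snd y) (x - fst y)
       - h * (time_weight h (snd y) * p (fst y) * ?L (snd y) (x - fst y)))"
    unfolding laplacian_resolvent unfolding resolvent_def
    by (subst Henstock_Kurzweil_Integration.integral_diff)
       (auto intro!: integrable_continuous continuous_intros cp pos)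
  also have "\<dots> = integral ?B (\<lambda>(y, s). F y s)"
    by (rule Henstock_Kurzweil_Integration.integral_cong)
       (use h in \<open>auto simp: F_def time_weight_def field_simps\<close>)
  also have "\<dots> = integral (cbox a b) (\<lambda>y. integral (cbox \<tau> T) (F y))"
    using integral_prod_continuous[OF cF] by simp
  also have "\<dots> = integral (cbox a b) (\<lambda>y. ?E \<tau> * (p y * heat \<tau> (x - y)) - ?E T * (p y * heat T (x - y)))"
  proof (rule Henstock_Kurzweil_Integration.integral_cong)
    fix y
    let ?I = "\<lambda>s. - p y * (?E s * heat s (x - y))"
    have "(F y has_integral ?I T - ?I \<tau>) {\<tau>..T}"
    proof (rule fundamental_theorem_of_calculus[OF \<open>\<tau> \<le> T\<close>])
      fix s assume "s \<in> {\<tau>..T}"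
      then have s: "s > 0" using \<tau> by auto
      have dE: "(?E has_field_derivative - s / h * ?E s) (at s)"
        using h by (auto intro!: derivative_eq_intros)
      have "(?I has_field_derivative F y s) (at s)"
        using DERIV_cmult[OF DERIV_mult[OF dE has_field_derivative_heat_scale[OF s, of "x - y"]], of "- p y"]
        by (rule DERIV_cong) (use h in \<open>simp add: F_def time_weight_def field_simps\<close>)
      then show "(?I has_vector_derivative F y s) (at s within {\<tau>..T})"
        by (simp add: has_real_derivative_iff_has_vector_derivative has_vector_derivative_at_within)
    qed
    then show "integral (cbox \<tau> T) (F y) = ?E \<tau> * (p y * heat \<tau> (x - y)) - ?E T * (p y * heat T (x - y))"
      by (simp add: integral_unique algebra_simps)
  qed
  also have "\<dots> = ?E \<tau> * integral (cbox a b) (\<lambda>y. p y * heat \<tau> (x - y))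
      - ?E T * integral (cbox a b) (\<lambda>y. p y * heat T (x - y))"
    using \<tau>
    by (subst Henstock_Kurzweil_Integration.integral_diff)
       (auto intro!: integrable_continuous continuous_intros cp)
  also have "\<dots> = ?E \<tau> * heat_mean \<tau> p x - ?E T * heat_mean T p x"
    using \<tau> by (simp add: integral_cbox_mult_heat[OF _ p supp])
  finally show ?thesis .
qed

text \<open>
  The same double integral with the time outside: an average of heat semigroup values, which
  transfers the bounds on \<^const>\<open>heat_mean\<close> to the resolvent.
\<close>

lemma has_integral_resolvent:
  "((\<lambda>s. time_weight h s * heat_mean s p x) has_integral resolvent h \<tau> T a b p x) {\<tau>..T}"
proof -
  note cp = continuous_on_compose2[OF p _ subset_UNIV]
  let ?F = "\<lambda>y s. time_weight h s * p y * heat s (x - y)"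
  have pos: "snd y > 0" if "y \<in> cbox (a, \<tau>) (b, T)" for y using that \<tau> by (cases y) auto
  have cF: "continuous_on (cbox (a, \<tau>) (b, T)) (\<lambda>(y, s). ?F y s)"
    unfolding split_beta by (intro continuous_intros cp pos) auto
  have inner: "integral (cbox a b) (\<lambda>y. ?F y s) = time_weight h s * heat_mean s p x" if "s \<in> cbox \<tau> T" for s
    using integral_cbox_mult_heat[of s p a b x, OF _ p supp] that \<tau> by (simp add: mult.assoc)
  have "resolvent h \<tau> T a b p x = integral (cbox a b) (\<lambda>y. integral (cbox \<tau> T) (?F y))"
    using integral_prod_continuous[OF cF] by (simp add: resolvent_def case_prod_unfold)
  also have "\<dots> = integral (cbox \<tau> T) (\<lambda>s. integral (cbox a b) (\<lambda>y. ?F y s))"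
    by (rule integral_swap_continuous[OF cF])
  also have "\<dots> = integral (cbox \<tau> T) (\<lambda>s. time_weight h s * heat_mean s p x)"
    by (rule Henstock_Kurzweil_Integration.integral_cong) (rule inner)
  finally have eq: "resolvent h \<tau> T a b p x = \<dots>" .
  have "continuous_on (cbox \<tau> T) (\<lambda>s. integral (cbox a b) (\<lambda>y. ?F y s))"
    by (rule integral_continuous_on_param)
       (unfold split_beta, intro continuous_intros cp, use \<tau> in auto)
  then have "continuous_on (cbox \<tau> T) (\<lambda>s. time_weight h s * heat_mean s p x)"
    by (rule continuous_on_eq) (rule inner)
  then show ?thesis
    unfolding eq box_real(2)[symmetric] by (intro integrable_integral integrable_continuous)
qed

lemma resolvent_nonneg:
  assumes "\<And>y. p y \<ge> 0" shows "resolvent h \<tau> T a b p x \<ge> 0"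
  by (rule has_integral_nonneg[OF has_integral_resolvent])
     (use h \<tau> in \<open>auto intro!: mult_nonneg_nonneg time_weight_nonneg heat_mean_nonneg assms\<close>)

lemma resolvent_increment:
  assumes h1: "h \<le> 1" and \<tau>1: "\<tau> \<le> 1" and B: "\<And>x. \<bar>p x\<bar> \<le> B" and D: "D \<ge> 0"
    and w: "\<And>x. \<bar>w (x + e) - w x\<bar> \<le> norm e"
    and v: "\<And>x. \<bar>(p (x + e) + w (x + e)) - (p x + w x)\<bar> \<le> norm e"
    and w2: "\<And>x y. \<bar>(w (x + e) - w x) - (w (y + e) - w y)\<bar> \<le> D * norm (x - y) * norm e"
  shows "\<bar>(resolvent h \<tau> T a b p (x + e) + w (x + e)) - (resolvent h \<tau> T a b p x + w x)\<bar>
    \<le> norm e * (1 + 4 * D * (\<integral>z. norm (z::real ^ 'n) * gauss z \<partial>lborel))"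
proof -
  let ?q = "resolvent h \<tau> T a b p"
  let ?d = "w (x + e) - w x"
  let ?k = "exp (- \<tau>\<^sup>2 / (2 * h)) - exp (- T\<^sup>2 / (2 * h))"
  let ?m = "\<integral>z. norm (z::real ^ 'n) * gauss z \<partial>lborel"
  have m: "?m \<ge> 0" by (intro Bochner_Integration.integral_nonneg) auto
  have [measurable]: "p \<in> borel_measurable borel"
    using p by (rule borel_measurable_continuous_onI)
  have I: "((\<lambda>s. time_weight h s * heat_mean s p (x + e) - time_weight h s * heat_mean s p x + time_weight h s * ?d)
      has_integral (?q (x + e) - ?q x + ?k * ?d)) {\<tau>..T}"
    by (intro has_integral_add has_integral_diff has_integral_resolvent
        has_integral_mult_left has_integral_time_weight h \<tau>)
  let ?R = "\<lambda>s. norm e * time_weight h s + (norm e * D * ?m) * (time_weight h s * s)"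
  have i2: "(\<lambda>s. time_weight h s * s) integrable_on {\<tau>..T}"
    by (intro integrable_continuous_interval continuous_intros)
  have J: "(?R has_integral (norm e * ?k + (norm e * D * ?m) * integral {\<tau>..T} (\<lambda>s. time_weight h s * s))) {\<tau>..T}"
    by (intro has_integral_add has_integral_mult_right has_integral_time_weight h \<tau> integrable_integral i2)
  have "\<bar>?q (x + e) - ?q x + ?k * ?d\<bar> \<le> norm e * ?k + (norm e * D * ?m) * integral {\<tau>..T} (\<lambda>s. time_weight h s * s)"
    unfolding integral_unique[OF I, symmetric] integral_unique[OF J, symmetric] real_norm_def[symmetric]
  proof (rule Henstock_Kurzweil_Integration.integral_norm_bound_integral)
    fix s assume "s \<in> {\<tau>..T}"
    then have s: "s \<ge> 0" using \<tau> by auto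
    have "\<bar>time_weight h s * (heat_mean s p (x + e) - heat_mean s p x + ?d)\<bar> \<le> time_weight h s * (norm e * (1 + D * s * ?m))"
      unfolding abs_mult using heat_mean_increment[OF s _ B v w2, of x] time_weight_nonneg[OF h s]
      by (intro mult_mono) auto
    then show "norm (time_weight h s * heat_mean s p (x + e) - time_weight h s * heat_mean s p x + time_weight h s * ?d) \<le> ?R s"
      by (simp add: algebra_simps)
  qed (use I J in blast)+
  also have "\<dots> \<le> norm e * ?k + (norm e * D * ?m) * 4"
    using D m h h1 \<tau> \<tau>1 by (intro add_left_mono mult_left_mono integral_time_weight_mult_le) auto
  finally have 1: "\<bar>?q (x + e) - ?q x + ?k * ?d\<bar> \<le> norm e * ?k + (norm e * D * ?m) * 4" .
  have k1: "?k \<le> 1"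
  proof -
    have "exp (- \<tau>\<^sup>2 / (2 * h)) \<le> 1" using h by simp
    then show ?thesis using exp_ge_zero[of "- T\<^sup>2 / (2 * h)"] by linarith
  qed
  \<comment> \<open>The truncated weight has mass \<open>?k \<le> 1\<close>; the missing part
     of the increment of \<open>w\<close> is estimated by the Lipschitz bound of \<open>w\<close>.\<close>
  have 2: "\<bar>(1 - ?k) * ?d\<bar> \<le> (1 - ?k) * norm e"
    unfolding abs_mult using k1 w[of x] by (intro mult_mono) auto
  have "(?q (x + e) + w (x + e)) - (?q x + w x) = (?q (x + e) - ?q x + ?k * ?d) + (1 - ?k) * ?d"
    by (simp add: algebra_simps)
  then have "\<bar>(?q (x + e) + w (x + e)) - (?q x + w x)\<bar> \<le> norm e * ?k + (norm e * D * ?m) * 4 + (1 - ?k) * norm e"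
    using 1 2 by linarith
  then show ?thesis by (simp add: algebra_simps)
qed

lemma resolvent_error:
  assumes B: "\<And>x. \<bar>p x\<bar> \<le> B" and nn: "\<And>x. p x \<ge> 0" and L: "\<And>x y. \<bar>p x - p y\<bar> \<le> L * norm (x - y)"
  shows "\<bar>resolvent h \<tau> T a b p x - h * laplacian (resolvent h \<tau> T a b p) x - p x\<bar>
    \<le> (1 - exp (- \<tau>\<^sup>2 / (2 * h))) * B + L * \<tau> * (\<integral>z. norm (z::real ^ 'n) * gauss z \<partial>lborel) + exp (- T\<^sup>2 / (2 * h)) * B"
proof -
  let ?E = "\<lambda>s. exp (- s\<^sup>2 / (2 * h))"
  have [measurable]: "p \<in> borel_measurable borel"
    using p by (rule borel_measurable_continuous_onI)
  have 1: "\<bar>heat_mean \<tau> p x - p x\<bar> \<le> L * \<tau> * (\<integral>z. norm (z::real ^ 'n) * gauss z \<partial>lborel)"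
    using \<tau> by (intro heat_mean_close[OF _ _ B L]) auto
  have 2: "heat_mean \<tau> p x \<le> B" "heat_mean T p x \<le> B" by (intro heat_mean_le[OF _ B], simp)+
  have 3: "heat_mean \<tau> p x \<ge> 0" "heat_mean T p x \<ge> 0" by (intro heat_mean_nonneg nn)+
  have E: "?E \<tau> \<le> 1" using h by simp
  have "\<bar>(1 - ?E \<tau>) * heat_mean \<tau> p x\<bar> \<le> (1 - ?E \<tau>) * B"
    unfolding abs_mult using E 2 3 by (intro mult_mono) auto
  moreover have "\<bar>?E T * heat_mean T p x\<bar> \<le> ?E T * B"
    unfolding abs_mult using 2 3 by (intro mult_mono) auto
  moreover have "resolvent h \<tau> T a b p x - h * laplacian (resolvent h \<tau> T a b p) x - p x
    = (heat_mean \<tau> p x - p x) - (1 - ?E \<tau>) * heat_mean \<tau> p x - ?E T * heat_mean T p x"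
    unfolding resolvent_equation by (simp add: algebra_simps)
  ultimately show ?thesis using 1 by linarith
qed

end

section \<open>Growth at infinity\<close>

lemma eventually_at_infinity_norm_ge:
  "\<forall>\<^sub>F x in at_infinity. (c::real) \<le> norm (x::'a::real_normed_vector)"
  by (auto simp: eventually_at_infinity)

lemma eventually_affine_norm_le:
  fixes K c d :: real
  assumes "d > 0"
  shows "\<forall>\<^sub>F x in at_infinity. c - d * norm (x::'a::real_normed_vector) \<le> K"
  using eventually_at_infinity_norm_ge[of "(c - K) / d"]
  by eventually_elim (use assms in \<open>simp add: field_simps\<close>)

lemma attains_max_of_eventually_le:
  fixes H :: "real ^ 'n \<Rightarrow> real"
  assumes c: "continuous_on UNIV H" and e: "\<forall>\<^sub>F x in at_infinity. H x \<le> H 0"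
  obtains x0 where "\<And>x. H x \<le> H x0"
proof -
  obtain r where r: "\<And>x. norm x \<ge> r \<Longrightarrow> H x \<le> H 0"
    using e by (auto simp: eventually_at_infinity)
  let ?K = "cball (0 :: real ^ 'n) (max r 0)"
  obtain x0 where x0: "x0 \<in> ?K" "\<And>x. x \<in> ?K \<Longrightarrow> H x \<le> H x0"
    using continuous_attains_sup[of ?K H] c continuous_on_subset by (metis cball_eq_empty compact_cball max.cobounded2 not_less subset_UNIV)
  have "H x \<le> H x0" for x
  proof (cases "norm x \<ge> r")
    case True
    then have "H x \<le> H 0" by (rule r)
    also have "\<dots> \<le> H x0" by (rule x0) simp
    finally show ?thesis .
  qed (use x0 in auto)
  then show ?thesis by (rule that)
qed

lemma exists_factor_less_one:
  fixes lam mu :: real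
  assumes "lam < mu"
  obtains \<theta> where "0 < \<theta>" "\<theta> < 1" "lam < \<theta> * mu"
proof -
  have "((\<lambda>\<theta>. \<theta> * mu) \<longlongrightarrow> 1 * mu) (at_left 1)" by (intro tendsto_intros)
  then have "\<forall>\<^sub>F \<theta> in at_left 1. lam < \<theta> * mu" using assms by (intro order_tendstoD) auto
  moreover have "\<forall>\<^sub>F \<theta> in at_left 1. 0 < \<theta> \<and> \<theta> < (1::real)"
    using eventually_at_left_real[of 0 "1::real"] by simp
  ultimately have "\<forall>\<^sub>F \<theta> in at_left 1. lam < \<theta> * mu \<and> 0 < \<theta> \<and> \<theta> < (1::real)"
    by (rule eventually_conj)
  then obtain \<theta> where "lam < \<theta> * mu \<and> 0 < \<theta> \<and> \<theta> < (1::real)"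
    using eventually_happens'[OF trivial_limit_at_left_real] by blast
  then show ?thesis using that by blast
qed

lemma eventually_growth:
  fixes u :: "real ^ 'n \<Rightarrow> real"
  assumes u: "((\<lambda>x. u x / norm x) \<longlongrightarrow> 1) at_infinity" and \<eta>: "\<eta> > 0"
  shows eventually_growth_upper: "\<forall>\<^sub>F x in at_infinity. u x \<le> (1 + \<eta>) * norm x"
    and eventually_growth_lower: "\<forall>\<^sub>F x in at_infinity. (1 - \<eta>) * norm x \<le> u x"
proof -
  have "\<forall>\<^sub>F x in at_infinity. u x / norm x < 1 + \<eta>" using u \<eta> by (intro order_tendstoD) auto
  with eventually_at_infinity_norm_ge[of 1]
  show "\<forall>\<^sub>F x in at_infinity. u x \<le> (1 + \<eta>) * norm x"
    by eventually_elim (auto simp: divide_simps split: if_splits)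
  have "\<forall>\<^sub>F x in at_infinity. 1 - \<eta> < u x / norm x" using u \<eta> by (intro order_tendstoD) auto
  with eventually_at_infinity_norm_ge[of 1]
  show "\<forall>\<^sub>F x in at_infinity. (1 - \<eta>) * norm x \<le> u x"
    by eventually_elim (auto simp: divide_simps split: if_splits)
qed

lemma eventually_growth_of_liminf:
  fixes \<psi> :: "real ^ 'n \<Rightarrow> real"
  assumes "liminf_growth_ge_1 \<psi>" and "\<eta> > 0"
  shows "\<forall>\<^sub>F x in at_infinity. (1 - \<eta>) * norm x \<le> \<psi> x"
proof -
  have "ereal (1 - \<eta>) < 1" using assms(2) by (simp add: one_ereal_def)
  also have "\<dots> \<le> Liminf at_infinity (\<lambda>x. ereal (\<psi> x / norm x))"
    using assms(1) by (simp add: liminf_growth_ge_1_def)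
  finally have "\<forall>\<^sub>F x in at_infinity. ereal (1 - \<eta>) < ereal (\<psi> x / norm x)"
    by (rule less_LiminfD)
  with eventually_at_infinity_norm_ge[of 1] show ?thesis
    by eventually_elim (auto simp: divide_simps split: if_splits)
qed

lemma eventually_ge_of_superlinear:
  assumes "superlinear f"
  shows "\<forall>\<^sub>F x in at_infinity. K \<le> f x"
proof -
  have "\<forall>\<^sub>F x in at_infinity. \<bar>K\<bar> \<le> f x / norm x"
    using assms by (simp add: superlinear_def filterlim_at_top)
  with eventually_at_infinity_norm_ge[of 1] show ?thesis
  proof eventually_elim
    case (elim x)
    then have "\<bar>K\<bar> * 1 \<le> \<bar>K\<bar> * norm x" by (intro mult_left_mono) auto
    also have "\<dots> \<le> f x" using elim by (auto simp: divide_simps split: if_splits)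
    finally show ?case by simp
  qed
qed

section \<open>Consequences of the viscosity inequalities\<close>

text \<open>
  For \<open>\<theta> < 1\<close> the function \<open>\<theta> \<phi>\<close> grows more slowly than \<open>u\<close>, so \<open>u - \<theta> \<phi>\<close> has a minimum and \<open>\<theta> \<phi>\<close> is a
  test function there. Its gradient is strictly shorter than 1, so the supersolution property of
  \<open>u\<close> must come from the second order part, and that fails once \<open>lam < \<theta> mu\<close>, because \<open>f \<ge> 0\<close>.
\<close>

lemma classical_subsolution_bound:
  fixes f u \<phi> :: "real ^ 'n \<Rightarrow> real"
  assumes u: "visc_supersolution f lam u" "continuous_on UNIV u"
    and growth: "((\<lambda>x. u x / norm x) \<longlongrightarrow> 1) at_infinity"
    and f: "\<And>x. 0 \<le> f x"
    and \<phi>: "Ck 2 \<phi>" "\<And>x. norm (grad \<phi> x) \<le> 1" and mu: "\<And>x. mu \<le> laplacian \<phi> x + f x"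
  shows "mu \<le> lam"
proof (rule ccontr)
  assume "\<not> mu \<le> lam"
  then obtain \<theta> where \<theta>: "0 < \<theta>" "\<theta> < 1" "lam < \<theta> * mu"
    using exists_factor_less_one[of lam mu] by force
  define \<eta> where "\<eta> = (1 - \<theta>) / 2"
  have \<eta>: "\<eta> > 0" using \<theta> by (simp add: \<eta>_def)
  define H where "H x = \<theta> * \<phi> x - u x" for x
  have cont: "continuous_on UNIV H" unfolding H_def by (intro continuous_intros u C2_continuous \<phi>)
  have "\<forall>\<^sub>F x in at_infinity. H x \<le> H 0"
    using eventually_growth_lower[OF growth \<eta>] eventually_affine_norm_le[OF \<eta>, of "\<theta> * \<phi> 0" "H 0"]
  proof eventually_elim
    case (elim x)
    have "\<phi> x \<le> \<phi> 0 + norm x"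
      using lipschitz_of_norm_grad_le[OF \<phi>, of x 0] by simp
    then have "\<theta> * \<phi> x \<le> \<theta> * (\<phi> 0 + norm x)" using \<theta> by (intro mult_left_mono) auto
    then show ?case using elim unfolding H_def \<eta>_def by (simp add: field_simps)
  qed
  with cont obtain y where y: "\<And>x. H x \<le> H y" by (rule attains_max_of_eventually_le) blast
  have "local_min_at (\<lambda>x. u x - \<theta> * \<phi> x) y"
    unfolding local_min_at_def using y by (intro always_eventually) (auto simp: H_def algebra_simps)
  then have "0 \<le> pde_op f lam (\<lambda>x. \<theta> * \<phi> x) y"
    using u(1) C2_scale_Ck[OF \<phi>(1)] unfolding visc_supersolution_def by blast
  moreover have "norm (grad (\<lambda>x. \<theta> * \<phi> x) y) < 1"
  proof -
    have "norm (grad (\<lambda>x. \<theta> * \<phi> x) y) \<le> \<theta> * 1"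
      using \<theta> \<phi>(2)[of y] by (simp add: grad_scale[OF \<phi>(1)])
    then show ?thesis using \<theta> by simp
  qed
  moreover have "lam < laplacian (\<lambda>x. \<theta> * \<phi> x) y + f y"
  proof -
    have "\<theta> * mu \<le> \<theta> * (laplacian \<phi> y + f y)" using \<theta> mu by (intro mult_left_mono) auto
    moreover have "\<theta> * f y \<le> 1 * f y" using \<theta> f by (intro mult_right_mono) auto
    ultimately show ?thesis using \<theta> by (simp add: laplacian_scale[OF \<phi>(1)] distrib_left)
  qed
  ultimately show False by (simp add: pde_op_def)
qed

text \<open>
  The dual argument: \<open>\<psi> / \<theta>\<close> with \<open>\<theta> < 1\<close> grows faster than \<open>u\<close> and touches \<open>u\<close> from above. The
  subsolution property bounds its gradient by 1, so the touching point lies in the region where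
  the gradient of \<open>\<psi>\<close> is strictly shorter than 1.
\<close>

lemma classical_supersolution_bound:
  fixes f u \<psi> :: "real ^ 'n \<Rightarrow> real"
  assumes u: "visc_subsolution f lam u" "continuous_on UNIV u"
    and growth: "((\<lambda>x. u x / norm x) \<longlongrightarrow> 1) at_infinity"
    and f: "\<And>x. 0 \<le> f x"
    and \<psi>: "Ck 2 \<psi>" "liminf_growth_ge_1 \<psi>"
    and M: "\<And>x. norm (grad \<psi> x) < 1 \<Longrightarrow> laplacian \<psi> x + f x \<le> M"
  shows "lam \<le> M"
proof (rule ccontr)
  assume "\<not> lam \<le> M"
  then obtain \<theta> where \<theta>: "0 < \<theta>" "\<theta> < 1" "M < \<theta> * lam"
    using exists_factor_less_one[of M lam] by force
  define \<eta> where "\<eta> = (1 - \<theta>) / 4"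
  have \<eta>: "\<eta> > 0" using \<theta> by (simp add: \<eta>_def)
  define H where "H x = \<theta> * u x - \<psi> x" for x
  have cont: "continuous_on UNIV H" unfolding H_def by (intro continuous_intros u C2_continuous \<psi>)
  have "\<forall>\<^sub>F x in at_infinity. H x \<le> H 0"
    using eventually_growth_upper[OF growth \<eta>] eventually_growth_of_liminf[OF \<psi>(2) \<eta>]
      eventually_affine_norm_le[OF \<eta>, of 0 "H 0"]
  proof eventually_elim
    case (elim x)
    have "\<theta> * u x \<le> \<theta> * ((1 + \<eta>) * norm x)" using \<theta> elim by (intro mult_left_mono) auto
    also have "\<dots> = (\<theta> + \<theta> * \<eta>) * norm x" by (simp add: algebra_simps)
    also have "\<dots> \<le> (\<theta> + 1 * \<eta>) * norm x" using \<theta> \<eta> by (intro mult_right_mono add_left_mono) auto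
    finally have "H x \<le> (\<theta> + \<eta>) * norm x - (1 - \<eta>) * norm x"
      using elim unfolding H_def by simp
    also have "\<dots> = - (2 * \<eta>) * norm x" by (simp add: \<eta>_def field_simps)
    also have "\<dots> \<le> 0 - \<eta> * norm x" using \<eta> by (simp add: mult_right_mono)
    finally show ?case using elim by simp
  qed
  with cont obtain y where y: "\<And>x. H x \<le> H y" by (rule attains_max_of_eventually_le) blast
  let ?\<phi> = "\<lambda>x. inverse \<theta> * \<psi> x"
  have "local_max_at (\<lambda>x. u x - ?\<phi> x) y"
    unfolding local_max_at_def
  proof (intro always_eventually allI)
    fix x
    have "inverse \<theta> * H x \<le> inverse \<theta> * H y" using y \<theta> by (intro mult_left_mono) auto
    then show "u x - ?\<phi> x \<le> u y - ?\<phi> y" using \<theta> by (simp add: H_def right_diff_distrib mult.assoc[symmetric])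
  qed
  then have "pde_op f lam ?\<phi> y \<le> 0"
    using u(1) C2_scale_Ck[OF \<psi>(1)] unfolding visc_subsolution_def by blast
  then have 1: "lam - inverse \<theta> * laplacian \<psi> y - f y \<le> 0" and 2: "inverse \<theta> * norm (grad \<psi> y) \<le> 1"
    using \<theta> by (simp_all add: pde_op_def laplacian_scale[OF \<psi>(1)] grad_scale[OF \<psi>(1)])
  from 2 have "norm (grad \<psi> y) < 1" using \<theta> by (simp add: divide_simps)
  from M[OF this] have "laplacian \<psi> y + f y \<le> M" .
  moreover have "\<theta> * lam - laplacian \<psi> y - \<theta> * f y \<le> 0"
    using mult_left_mono[OF 1, of \<theta>] \<theta> by (simp add: right_diff_distrib mult.assoc[symmetric])
  moreover have "\<theta> * f y \<le> 1 * f y" using \<theta> f by (intro mult_right_mono) auto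
  ultimately show False using \<theta> by simp
qed

text \<open>
  The function \<open>(1 + \<epsilon>) * soft_norm s (x - y)\<close> outgrows \<open>u\<close> and has gradient longer than 1 except
  within distance \<open>s / \<epsilon>\<close> of \<open>y\<close>. Its contact point with \<open>u\<close> must therefore lie in this small ball, where
  \<open>u\<close> is close to \<open>u y\<close>.
\<close>

lemma visc_subsolution_lipschitz:
  fixes u :: "real ^ 'n \<Rightarrow> real"
  assumes u: "visc_subsolution f lam u" "continuous_on UNIV u"
    and growth: "((\<lambda>x. u x / norm x) \<longlongrightarrow> 1) at_infinity"
  shows "\<bar>u x - u y\<bar> \<le> norm (x - y)"
proof -
  have main: "u x \<le> u y + \<epsilon> + (1 + \<epsilon>) * (\<epsilon> + norm (x - y))" if \<epsilon>: "\<epsilon> > 0" for \<epsilon> x y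
  proof -
    have "isCont u y" using u(2) by (simp add: continuous_on_eq_continuous_at)
    then obtain d where d: "d > 0" "\<And>z. dist z y < d \<Longrightarrow> dist (u z) (u y) < \<epsilon>"
      using \<epsilon> by (auto simp: continuous_at_eps_delta)
    define s where "s = min \<epsilon> (\<epsilon> * d / 2)"
    have s: "s > 0" "s \<le> \<epsilon>" "s < \<epsilon> * d" using \<epsilon> d by (auto simp: s_def min_def)
    let ?\<phi> = "\<lambda>x. (1 + \<epsilon>) * soft_norm s (x - y)"
    define H where "H x = u x - ?\<phi> x" for x
    have cont: "continuous_on UNIV H"
      unfolding H_def by (intro continuous_intros u C2_continuous[OF C2_soft_norm] s)
    have "\<forall>\<^sub>F x in at_infinity. H x \<le> H 0"
      using eventually_growth_upper[OF growth half_gt_zero[OF \<epsilon>]] eventually_affine_norm_le[of "\<epsilon> / 2" "(1 + \<epsilon>) * norm y" "H 0", OF half_gt_zero[OF \<epsilon>]]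
    proof eventually_elim
      case (elim x)
      have "norm x - norm y \<le> soft_norm s (x - y)"
        using soft_norm_ge(1)[of "x - y" s] norm_triangle_ineq2[of x y] by simp
      then have "(1 + \<epsilon>) * (norm x - norm y) \<le> ?\<phi> x" using \<epsilon> by (intro mult_left_mono) auto
      then show ?case using elim \<epsilon> by (simp add: H_def algebra_simps)
    qed
    with cont obtain z where z: "\<And>x. H x \<le> H z" by (rule attains_max_of_eventually_le) blast
    have "local_max_at (\<lambda>x. u x - ?\<phi> x) z"
      unfolding local_max_at_def using z by (intro always_eventually) (auto simp: H_def)
    then have "pde_op f lam ?\<phi> z \<le> 0"
      using u(1) C2_scale_Ck[OF C2_soft_norm[OF s(1)]] unfolding visc_subsolution_def by blast
    then have "norm (grad ?\<phi> z) \<le> 1" by (simp add: pde_op_def)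
    then have "(1 + \<epsilon>) * norm (z - y) / soft_norm s (z - y) \<le> 1"
      using \<epsilon> soft_norm_pos[OF s(1), of "z - y"]
      by (simp add: grad_scale[OF C2_soft_norm[OF s(1)]] grad_soft_norm[OF s(1)] divide_inverse_commute mult_ac)
    then have "(1 + \<epsilon>) * norm (z - y) \<le> soft_norm s (z - y)"
      using soft_norm_pos[OF s(1), of "z - y"] by (simp add: divide_simps)
    also have "\<dots> \<le> s + norm (z - y)" using s by (intro soft_norm_le) auto
    finally have "\<epsilon> * norm (z - y) \<le> s" by (simp add: algebra_simps)
    also have "\<dots> < \<epsilon> * d" by fact
    finally have "dist z y < d" using \<epsilon> by (simp add: dist_norm)
    then have uz: "u z \<le> u y + \<epsilon>" using d(2)[of z] by (auto simp: dist_real_def)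
    have "u x - ?\<phi> x \<le> u z - ?\<phi> z" using z[of x] by (simp add: H_def)
    also have "\<dots> \<le> u z" using \<epsilon> soft_norm_pos[OF s(1), of "z - y"] by simp
    finally have "u x \<le> u y + \<epsilon> + ?\<phi> x" using uz by simp
    also have "?\<phi> x \<le> (1 + \<epsilon>) * (\<epsilon> + norm (x - y))"
      using \<epsilon> s soft_norm_le[of s "x - y"] by (intro mult_left_mono) auto
    finally show ?thesis by simp
  qed
  have le: "u x \<le> u y + norm (x - y)" for x y
  proof (rule tendsto_lowerbound)
    have "((\<lambda>\<epsilon>. u y + \<epsilon> + (1 + \<epsilon>) * (\<epsilon> + norm (x - y))) \<longlongrightarrow> u y + 0 + (1 + 0) * (0 + norm (x - y))) (at_right 0)"
      by (intro tendsto_intros)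
    then show "((\<lambda>\<epsilon>. u y + \<epsilon> + (1 + \<epsilon>) * (\<epsilon> + norm (x - y))) \<longlongrightarrow> u y + norm (x - y)) (at_right 0)"
      by simp
    show "\<forall>\<^sub>F \<epsilon> in at_right 0. u x \<le> u y + \<epsilon> + (1 + \<epsilon>) * (\<epsilon> + norm (x - y))"
      using eventually_at_right_less[of 0] by eventually_elim (rule main)
  qed simp
  show ?thesis using le[of x y] le[of y x] by (simp add: abs_le_iff norm_minus_commute)
qed

text \<open>
  Times for which the error term in \<open>resolvent_error\<close>, with Lipschitz constant 2, is at most \<open>\<delta>\<close>.
\<close>

lemma exists_time_window:
  fixes B h m \<delta> :: real
  assumes h: "h > 0" and \<delta>: "\<delta> > 0"
  obtains \<tau> T where "0 < \<tau>" "\<tau> \<le> 1" "\<tau> \<le> T"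
    "(1 - exp (- \<tau>\<^sup>2 / (2 * h))) * B + 2 * \<tau> * m + exp (- T\<^sup>2 / (2 * h)) * B \<le> \<delta>"
proof -
  have "((\<lambda>\<tau>. (1 - exp (- \<tau>\<^sup>2 / (2 * h))) * B + 2 * \<tau> * m) \<longlongrightarrow> (1 - exp (- 0\<^sup>2 / (2 * h))) * B + 2 * 0 * m) (at_right 0)"
    using h by (intro tendsto_intros) auto
  then have "\<forall>\<^sub>F \<tau> in at_right 0. (1 - exp (- \<tau>\<^sup>2 / (2 * h))) * B + 2 * \<tau> * m < \<delta> / 2"
    using \<delta> by (intro order_tendstoD) auto
  moreover have "\<forall>\<^sub>F \<tau> in at_right 0. 0 < \<tau> \<and> \<tau> < (1::real)"
    using eventually_at_right_real[of 0 "1::real"] by simp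
  ultimately have "\<forall>\<^sub>F \<tau> in at_right 0. (1 - exp (- \<tau>\<^sup>2 / (2 * h))) * B + 2 * \<tau> * m < \<delta> / 2 \<and> 0 < \<tau> \<and> \<tau> < (1::real)"
    by (rule eventually_conj)
  then obtain \<tau> where \<tau>: "(1 - exp (- \<tau>\<^sup>2 / (2 * h))) * B + 2 * \<tau> * m < \<delta> / 2" "0 < \<tau>" "\<tau> < 1"
    using eventually_happens'[OF trivial_limit_at_right_real] by blast
  have "filterlim (\<lambda>T. T\<^sup>2 * (1 / (2 * h))) at_top at_top"
    using h by (intro filterlim_at_top_mult_tendsto_pos[OF tendsto_const] filterlim_pow_at_top filterlim_ident) auto
  then have "((\<lambda>T. exp (- (T\<^sup>2 * (1 / (2 * h)))) * B) \<longlongrightarrow> 0 * B) at_top"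
    by (intro tendsto_intros filterlim_compose[OF exp_at_bot] filterlim_uminus_at_bot[THEN iffD2]) simp
  then have "\<forall>\<^sub>F T in at_top. exp (- (T\<^sup>2 * (1 / (2 * h)))) * B < \<delta> / 2"
    using \<delta> by (intro order_tendstoD) auto
  then have "\<forall>\<^sub>F T in at_top. exp (- (T\<^sup>2 * (1 / (2 * h)))) * B < \<delta> / 2 \<and> 1 \<le> T"
    using eventually_ge_at_top by (rule eventually_conj)
  then obtain T where T: "exp (- (T\<^sup>2 * (1 / (2 * h)))) * B < \<delta> / 2" "1 \<le> T"
    using eventually_happens'[OF trivial_limit_at_top_linorder] by blast
  show ?thesis by (rule that[of \<tau> T]) (use \<tau> T in auto)
qed

section \<open>Smoothing the subsolution\<close>

text \<open>
  A smooth almost subsolution, with a loss that vanishes as \<open>\<epsilon> \<rightarrow> 0\<close>. With \<open>w\<close> a smooth cone of large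
  radius of curvature \<open>S\<close>, shifted down so far that it lies above \<open>\<theta> u\<close> only where \<open>f \<ge> lam\<close>, and
  \<open>p\<close> the excess of \<open>\<theta> u\<close> over \<open>w\<close>, the function \<open>w + p\<close> is the maximum of \<open>\<theta> u\<close> and \<open>w\<close>, and \<open>p\<close> has compact
  support. The smooth function is \<open>w + q\<close> with \<open>q\<close> the resolvent of \<open>p\<close>, multiplied by \<open>\<theta>\<close> to bring the Lipschitz
  constant down to 1.

  Since \<open>h \<Delta>q\<close> is nearly \<open>q - p\<close>, a lower bound on \<open>\<Delta>q\<close> is an upper bound on \<open>p - q\<close>. At a maximum of
  \<open>H = p - q - h \<theta> (f - lam)\<close> with \<open>p > 0\<close> the function \<open>u\<close> is touched from above by a smooth function built
  from \<open>w\<close>, \<open>q\<close> and \<open>f\<close>, and the subsolution property bounds \<open>\<Delta>q\<close> below at this point, hence the maximum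
  of \<open>H\<close> above. The bound on \<open>H\<close> everywhere then gives the bound on \<open>\<Delta>q\<close> everywhere.
\<close>

lemma exists_smooth_subsolution:
  fixes f u :: "real ^ 'n \<Rightarrow> real"
  assumes sub: "visc_subsolution f lam u" and cu: "continuous_on UNIV u"
    and growth: "((\<lambda>x. u x / norm x) \<longlongrightarrow> 1) at_infinity"
    and f: "Ck 2 f" "\<And>x. 0 \<le> f x" "superlinear f"
    and \<epsilon>: "\<epsilon> > 0"
  defines "\<theta> \<equiv> 1 / (1 + \<epsilon>)"
  obtains \<phi> where "Ck 2 \<phi>" "\<And>x. norm (grad \<phi> x) \<le> 1" "\<And>x. \<theta>\<^sup>2 * lam - 4 * \<epsilon> \<le> laplacian \<phi> x + f x"
proof -
  have \<theta>: "0 < \<theta>" "\<theta> < 1" "\<theta> * (1 + \<epsilon>) = 1" using \<epsilon> by (auto simp: \<theta>_def)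
  define m where "m = (\<integral>z. norm (z::real ^ 'n) * gauss z \<partial>lborel)"
  have m: "m \<ge> 0" unfolding m_def by (intro Bochner_Integration.integral_nonneg) auto
  \<comment> \<open>\<open>S\<close> makes both the Laplacian of \<open>w\<close> and the error in the Lipschitz constant of \<open>w + q\<close> at most \<open>\<epsilon>\<close>.\<close>
  define S where "S = CARD('n) / \<epsilon> + 8 * m / \<epsilon> + 1"
  have S: "S > 0" using \<epsilon> m unfolding S_def by (intro add_nonneg_pos add_nonneg_nonneg) auto
  have S1: "CARD('n) / S \<le> \<epsilon>" and S2: "4 * (2 / S) * m \<le> \<epsilon>"
    using S \<epsilon> m by (auto simp: S_def divide_simps)
  obtain R0 where R0: "\<And>x. norm x \<ge> R0 \<Longrightarrow> lam \<le> f x"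
    using eventually_ge_of_superlinear[OF f(3), of lam] by (auto simp: eventually_at_infinity)
  let ?s = "\<lambda>x. soft_norm S (x - 0)"
  have cs: "continuous_on A ?s" for A :: "(real ^ 'n) set"
    by (rule continuous_on_subset[OF C2_continuous[OF C2_soft_norm[OF S]]]) simp
  have "compact ((\<lambda>x. ?s x - \<theta> * u x) ` cball 0 R0)"
    by (intro compact_continuous_image continuous_intros cs continuous_on_subset[OF cu]) auto
  then have "bdd_above ((\<lambda>x. ?s x - \<theta> * u x) ` cball 0 R0)" by (intro bounded_imp_bdd_above compact_imp_bounded)
  then obtain C where C: "\<And>x. norm x \<le> R0 \<Longrightarrow> ?s x - \<theta> * u x \<le> C"
    unfolding bdd_above_def by force
  define w :: "real ^ 'n \<Rightarrow> real" where "w x = ?s x - (C + 1)" for x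
  have w_eq: "w = (\<lambda>x. 1 * ?s x + 0 * ?s x + - (C + 1))" by (auto simp: w_def)
  have w2: "Ck 2 w" and lapw: "laplacian w x = laplacian ?s x" for x
    unfolding w_eq using C2_lincomb[OF C2_soft_norm[OF S] C2_soft_norm[OF S], of 1 0 0 0 "- (C + 1)"] by auto
  have lapw0: "0 \<le> laplacian w x" and lapw1: "laplacian w x \<le> \<epsilon>" for x
    unfolding lapw using laplacian_soft_norm_nonneg[OF S, of 0 x] laplacian_soft_norm_le[OF S, of 0 x] S1 by auto
  have w_lip: "\<bar>w x - w y\<bar> \<le> norm (x - y)" for x y
    unfolding w_def using soft_norm_lipschitz[of S x y] by simp
  have u_lip: "\<bar>u x - u y\<bar> \<le> norm (x - y)" for x y
    by (rule visc_subsolution_lipschitz[OF sub cu growth])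
  have \<theta>u_lip: "\<bar>\<theta> * u x - \<theta> * u y\<bar> \<le> norm (x - y)" for x y
  proof -
    have "\<bar>\<theta> * u x - \<theta> * u y\<bar> = \<theta> * \<bar>u x - u y\<bar>" using \<theta> by (simp add: right_diff_distrib[symmetric] abs_mult)
    also have "\<dots> \<le> 1 * norm (x - y)" using \<theta> u_lip by (intro mult_mono) auto
    finally show ?thesis by simp
  qed
  have inner_region: "w x < \<theta> * u x" if "f x < lam" for x
    using C[of x] R0[of x] that by (force simp: w_def)
  define p :: "real ^ 'n \<Rightarrow> real" where "p x = max (\<theta> * u x - w x) 0" for x
  have p0: "0 \<le> p x" "\<theta> * u x - w x \<le> p x" for x by (auto simp: p_def)
  have cp: "continuous_on UNIV p" unfolding p_def w_def by (intro continuous_intros cu cs)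
  \<comment> \<open>A rate \<open>\<eta> < \<epsilon>\<close> keeps the growth of \<open>\<theta> u\<close> strictly below that of \<open>w\<close>.\<close>
  define \<eta> where "\<eta> = \<epsilon> / 2"
  have \<eta>: "\<eta> > 0" "1 - \<theta> * (1 + \<eta>) > 0" using \<epsilon> by (auto simp: \<eta>_def \<theta>_def divide_simps)
  have "\<forall>\<^sub>F x in at_infinity. p x = 0"
    using eventually_growth_upper[OF growth \<eta>(1)] eventually_affine_norm_le[OF \<eta>(2), of "C + 1" 0]
  proof eventually_elim
    case (elim x)
    have "\<theta> * u x \<le> \<theta> * ((1 + \<eta>) * norm x)" using \<theta> elim by (intro mult_left_mono) auto
    moreover have "norm x \<le> ?s x" using soft_norm_ge(1)[of x S] by simp
    ultimately have "\<theta> * u x - w x \<le> 0" using elim by (simp add: w_def algebra_simps)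
    then show ?case by (simp add: p_def)
  qed
  then obtain R where R: "\<And>x. norm x \<ge> R \<Longrightarrow> p x = 0" by (auto simp: eventually_at_infinity)
  obtain b where b: "cball (0 :: real ^ 'n) R \<subseteq> cbox (- b) b"
    using bounded_subset_cbox_symmetric[OF bounded_cball] by blast
  have supp: "p y = 0" if "y \<notin> cbox (- b) b" for y
    using b that R[of y] by force
  have bdd: "\<exists>B\<ge>0. \<forall>x\<in>cball 0 R. \<bar>g x\<bar> \<le> B" if "continuous_on UNIV g" for g :: "real ^ 'n \<Rightarrow> real"
  proof -
    have "bounded (g ` cball 0 R)"
      by (intro compact_imp_bounded compact_continuous_image continuous_on_subset[OF that]) auto
    then obtain B where "B > 0" "\<And>y. y \<in> g ` cball 0 R \<Longrightarrow> norm y \<le> B" unfolding bounded_pos by blast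
    then show ?thesis by (intro exI[of _ B]) auto
  qed
  obtain B where B: "B \<ge> 0" "\<And>x. norm x \<le> R \<Longrightarrow> \<bar>p x\<bar> \<le> B" using bdd[OF cp] by auto
  have pB: "\<bar>p x\<bar> \<le> B" for x using B R[of x] by (cases "norm x \<le> R") auto
  obtain A where A: "A \<ge> 0" "\<And>x. norm x \<le> R \<Longrightarrow> \<bar>laplacian f x\<bar> \<le> A"
    using bdd[OF C2_continuous_laplacian[OF f(1)]] by auto
  have p_lip: "\<bar>p x - p y\<bar> \<le> 2 * norm (x - y)" for x y
    using \<theta>u_lip[of x y] w_lip[of x y] unfolding p_def by (auto simp: abs_le_iff max_def)
  \<comment> \<open>The term \<open>h \<theta> f\<close> of the test function contributes \<open>h \<theta> \<Delta>f\<close>; as only points with \<open>p > 0\<close> matter,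
    the bound \<open>A\<close> on a ball is enough to make it at most \<open>\<epsilon>\<close>.\<close>
  define h where "h = min 1 (\<epsilon> / (A + 1))"
  have h: "0 < h" "h \<le> 1" "h * A \<le> \<epsilon>"
  proof -
    show "0 < h" "h \<le> 1" using A \<epsilon> by (auto simp: h_def)
    have "h * A \<le> \<epsilon> / (A + 1) * A" using A by (intro mult_right_mono) (auto simp: h_def)
    also have "\<dots> \<le> \<epsilon>" using A \<epsilon> by (simp add: divide_simps)
    finally show "h * A \<le> \<epsilon>" .
  qed
  have "\<epsilon> * h > 0" using \<epsilon> h by simp
  then obtain \<tau> T where \<tau>: "0 < \<tau>" "\<tau> \<le> 1" "\<tau> \<le> T"
    and err: "(1 - exp (- \<tau>\<^sup>2 / (2 * h))) * B + 2 * \<tau> * m + exp (- T\<^sup>2 / (2 * h)) * B \<le> \<epsilon> * h"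
    using exists_time_window[OF h(1)] by metis
  define q where "q = resolvent h \<tau> T (- b) b p"
  note ctx = h(1) \<tau>(1,3) cp supp
  have q2: "Ck 2 q" unfolding q_def by (rule C2_resolvent[OF ctx])
  have q0: "q x \<ge> 0" for x unfolding q_def by (rule resolvent_nonneg[OF ctx p0(1)])
  have q_eq: "\<bar>q x - h * laplacian q x - p x\<bar> \<le> \<epsilon> * h" for x
  proof -
    have "\<bar>q x - h * laplacian q x - p x\<bar>
      \<le> (1 - exp (- \<tau>\<^sup>2 / (2 * h))) * B + 2 * \<tau> * m + exp (- T\<^sup>2 / (2 * h)) * B"
      unfolding q_def m_def by (rule resolvent_error[OF ctx pB p0(1) p_lip])
    then show ?thesis using err by simp
  qed
  have wq_lip: "\<bar>(q (x + e) + w (x + e)) - (q x + w x)\<bar> \<le> (1 + \<epsilon>) * norm e" for x e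
  proof -
    have "\<bar>(q (x + e) + w (x + e)) - (q x + w x)\<bar> \<le> norm e * (1 + 4 * (2 / S) * m)"
      unfolding q_def m_def
    proof (rule resolvent_increment[OF ctx h(2) \<tau>(2) pB])
      show "\<bar>w (y + e) - w y\<bar> \<le> norm e" for y using w_lip[of "y + e" y] by simp
      show "\<bar>(p (y + e) + w (y + e)) - (p y + w y)\<bar> \<le> norm e" for y
        using w_lip[of "y + e" y] \<theta>u_lip[of "y + e" y] unfolding p_def by (auto simp: abs_le_iff max_def)
      show "\<bar>(w (y + e) - w y) - (w (z + e) - w z)\<bar> \<le> 2 / S * norm (y - z) * norm e" for y z
        using soft_norm_second_difference[OF S, of y e z] by (simp add: w_def)
    qed (use S in auto)
    also have "\<dots> \<le> norm e * (1 + \<epsilon>)" using S2 by (intro mult_left_mono) auto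
    finally show ?thesis by (simp add: mult.commute)
  qed

  define H :: "real ^ 'n \<Rightarrow> real" where "H x = p x - q x - h * \<theta> * (f x - lam)" for x
  have h\<theta>: "h * \<theta> > 0" using h \<theta> by simp
  have cH: "continuous_on UNIV H"
    unfolding H_def by (intro continuous_intros cp C2_continuous q2 f)
  have "\<forall>\<^sub>F x in at_infinity. H x \<le> H 0"
    using eventually_ge_of_superlinear[OF f(3), of "lam + (B - H 0) / (h * \<theta>)"]
  proof eventually_elim
    case (elim x)
    have "B - H 0 = h * \<theta> * ((B - H 0) / (h * \<theta>))" using h \<theta> by simp
    also have "\<dots> \<le> h * \<theta> * (f x - lam)" using elim h\<theta> by (intro mult_left_mono) auto
    finally show ?case using pB[of x] q0[of x] unfolding H_def[of x] by linarith
  qed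
  with cH obtain x0 where x0: "\<And>x. H x \<le> H x0" by (rule attains_max_of_eventually_le) blast
  have "H x0 \<le> 3 * \<epsilon> * h"
  proof (cases "p x0 = 0")
    case True
    then have "lam \<le> f x0" using inner_region[of x0] by (force simp: p_def)
    then have "0 \<le> h * \<theta> * (f x0 - lam)" using h \<theta> by (intro mult_nonneg_nonneg) auto
    then have "H x0 \<le> 0" using True q0[of x0] by (simp add: H_def)
    also have "\<dots> \<le> 3 * \<epsilon> * h" using \<epsilon> h by simp
    finally show ?thesis .
  next
    case False
    then have x0R: "norm x0 \<le> R" using R[of x0] by force
    have px0: "p x0 = \<theta> * u x0 - w x0" using False by (auto simp: p_def max_def split: if_splits)
    have inv: "\<theta> * (inverse \<theta> * X) = X" for X
      using \<theta> by (simp add: mult.assoc[symmetric])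
    let ?k = "inverse \<theta>"
    \<comment> \<open>The test function \<open>(w + q + h \<theta> (f - lam)) / \<theta>\<close>, arranged as two linear combinations of two functions.\<close>
    let ?wq = "\<lambda>x. ?k * w x + ?k * q x + 0"
    let ?\<Phi> = "\<lambda>x. 1 * ?wq x + h * f x + - (h * lam)"
    note wq = C2_lincomb[OF w2 q2, of ?k ?k 0]
    note \<Phi> = C2_lincomb[OF wq(1) f(1), of 1 h "- (h * lam)"]
    have \<Phi>_eq: "\<theta> * (u x - ?\<Phi> x) = (\<theta> * u x - w x) - q x - h * \<theta> * (f x - lam)" for x
      by (simp add: algebra_simps inv)
    have "local_max_at (\<lambda>x. u x - ?\<Phi> x) x0"
      unfolding local_max_at_def
    proof (intro always_eventually allI)
      fix x
      have "\<theta> * (u x - ?\<Phi> x) \<le> H x" unfolding \<Phi>_eq H_def using p0(2)[of x] by simp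
      also have "\<dots> \<le> H x0" by (rule x0)
      also have "\<dots> = \<theta> * (u x0 - ?\<Phi> x0)" unfolding \<Phi>_eq H_def px0 ..
      finally show "u x - ?\<Phi> x \<le> u x0 - ?\<Phi> x0" using \<theta> by (simp only: mult_le_cancel_left_pos)
    qed
    then have "pde_op f lam ?\<Phi> x0 \<le> 0"
      using sub \<Phi>(1) unfolding visc_subsolution_def by blast
    then have "lam - laplacian ?\<Phi> x0 - f x0 \<le> 0" unfolding pde_op_def by simp
    then have "\<theta> * (lam - laplacian ?\<Phi> x0 - f x0) \<le> 0" using \<theta> by (simp add: mult_le_0_iff)
    moreover have "\<theta> * laplacian ?\<Phi> x0 = laplacian w x0 + laplacian q x0 + h * \<theta> * laplacian f x0"
      unfolding \<Phi>(3) wq(3) by (simp add: algebra_simps inv)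
    ultimately have "\<theta> * (lam - f x0) \<le> laplacian w x0 + laplacian q x0 + h * \<theta> * laplacian f x0"
      by (simp add: algebra_simps)
    moreover have "h * \<theta> * laplacian f x0 \<le> \<epsilon>"
    proof -
      have "h * \<theta> * laplacian f x0 \<le> (h * \<theta>) * A"
        using h\<theta> A(2)[OF x0R] by (intro mult_left_mono) auto
      also have "\<dots> = \<theta> * (h * A)" by simp
      also have "\<dots> \<le> 1 * (h * A)" using \<theta> h A by (intro mult_right_mono) auto
      also have "\<dots> \<le> \<epsilon>" using h(3) by simp
      finally show ?thesis .
    qed
    ultimately have "\<theta> * (lam - f x0) - 2 * \<epsilon> \<le> laplacian q x0" using lapw1[of x0] by linarith
    then have "h * (\<theta> * (lam - f x0) - 2 * \<epsilon>) \<le> h * laplacian q x0" using h by (intro mult_left_mono) auto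
    then show ?thesis
      using q_eq[of x0] unfolding H_def abs_le_iff by (simp add: algebra_simps)
  qed
  then have lapq: "\<theta> * (lam - f x) - 4 * \<epsilon> \<le> laplacian q x" for x
  proof -
    have "H x \<le> 3 * \<epsilon> * h" using x0[of x] \<open>H x0 \<le> 3 * \<epsilon> * h\<close> by simp
    then have "h * (\<theta> * (lam - f x) - 4 * \<epsilon>) \<le> h * laplacian q x"
      using q_eq[of x] unfolding H_def abs_le_iff by (simp add: algebra_simps)
    then show ?thesis using h by (simp only: mult_le_cancel_left_pos)
  qed

  let ?\<phi> = "\<lambda>x. \<theta> * q x + \<theta> * w x + 0"
  note lin = C2_lincomb[OF q2 w2, of \<theta> \<theta> 0]
  show thesis
  proof (rule that[of ?\<phi>])
    show "Ck 2 ?\<phi>" by (rule lin(1))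
    show "norm (grad ?\<phi> x) \<le> 1" for x
    proof (rule norm_grad_le_of_lipschitz[OF C2_has_derivative[OF lin(1)]])
      fix e
      have "\<bar>?\<phi> (x + e) - ?\<phi> x\<bar> = \<theta> * \<bar>(q (x + e) + w (x + e)) - (q x + w x)\<bar>"
      proof -
        have "?\<phi> (x + e) - ?\<phi> x = \<theta> * ((q (x + e) + w (x + e)) - (q x + w x))"
          by (simp add: algebra_simps)
        then show ?thesis using \<theta> by (simp only: abs_mult)
      qed
      also have "\<dots> \<le> \<theta> * ((1 + \<epsilon>) * norm e)" using wq_lip \<theta> by (intro mult_left_mono) auto
      also have "\<dots> = 1 * norm e" using \<theta>(3) by (simp only: mult.assoc[symmetric])
      finally show "\<bar>?\<phi> (x + e) - ?\<phi> x\<bar> \<le> 1 * norm e" .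
    qed
    show "\<theta>\<^sup>2 * lam - 4 * \<epsilon> \<le> laplacian ?\<phi> x + f x" for x
    proof -
      have "\<theta> * (\<theta> * (lam - f x) - 4 * \<epsilon>) \<le> \<theta> * laplacian q x" using lapq \<theta> by (intro mult_left_mono) auto
      moreover have "0 \<le> \<theta> * laplacian w x" using \<theta> lapw0 by simp
      moreover have "\<theta>\<^sup>2 * f x \<le> 1 * f x" using \<theta> f(2) by (intro mult_right_mono) (auto simp: power_le_one)
      moreover have "\<theta> * (4 * \<epsilon>) \<le> 1 * (4 * \<epsilon>)" using \<theta> \<epsilon> by (intro mult_right_mono) auto
      ultimately show ?thesis unfolding lin(3) by (simp add: algebra_simps power2_eq_square)
    qed
  qed
qed

section \<open>The characterization of the eigenvalue\<close>

theorem theorem1p4: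
  fixes f :: "real ^ 'n \<Rightarrow> real" and lam_star :: real
  assumes "Cinf f" and "convex_on UNIV f" and "\<forall>x. 0 \<le> f x" and "superlinear f"
    and "is_eigenvalue f lam_star"
  shows "lambda_minus f = ereal lam_star \<and> ereal lam_star \<le> lambda_plus f \<and>
    ((\<exists>\<psi>. Ck 2 \<psi> \<and> visc_supersolution f lam_star \<psi> \<and> liminf_growth_ge_1 \<psi>)
      \<longrightarrow> ereal lam_star = lambda_plus f)"
proof (intro conjI impI)
  have f: "Ck 2 f" "\<And>x. 0 \<le> f x" using assms(1,3) unfolding Cinf_def by blast+
  obtain u where u: "visc_solution f lam_star u" and growth: "((\<lambda>x. u x / norm x) \<longlongrightarrow> 1) at_infinity"
    using assms(5) unfolding is_eigenvalue_def by (elim exE conjE)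
  have cu: "continuous_on UNIV u" and sub: "visc_subsolution f lam_star u"
    and super: "visc_supersolution f lam_star u"
    using u by (simp_all only: visc_solution_def)
  show "lambda_minus f = ereal lam_star"
  proof (rule antisym)
    show "lambda_minus f \<le> ereal lam_star"
      unfolding lambda_minus_def
    proof (rule SUP_least, rule ccontr)
      fix \<phi> :: "real ^ 'n \<Rightarrow> real"
      assume "\<phi> \<in> {\<phi>. Ck 2 \<phi> \<and> (\<forall>x. norm (grad \<phi> x) \<le> 1)}"
      then have \<phi>: "Ck 2 \<phi>" "\<forall>x. norm (grad \<phi> x) \<le> 1" by blast+
      assume "\<not> (INF x. ereal (laplacian \<phi> x + f x)) \<le> ereal lam_star"
      then have "ereal lam_star < (INF x. ereal (laplacian \<phi> x + f x))" by (simp only: not_le)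
      then obtain mu where mu: "ereal lam_star < ereal mu" "ereal mu < (INF x. ereal (laplacian \<phi> x + f x))"
        using ereal_dense2 by blast
      have "mu \<le> laplacian \<phi> x + f x" for x
        using less_INF_D[OF mu(2), of x] by simp
      then have "mu \<le> lam_star"
        using classical_subsolution_bound[OF super cu growth f(2) \<phi>(1)] \<phi>(2) by blast
      with mu(1) show False by simp
    qed
    show "ereal lam_star \<le> lambda_minus f"
    proof (rule ccontr)
      assume "\<not> ereal lam_star \<le> lambda_minus f"
      then have "lambda_minus f < ereal lam_star" by (simp only: not_le)
      then obtain mu where mu: "lambda_minus f < ereal mu" "mu < lam_star"
        using ereal_dense2[of "lambda_minus f" "ereal lam_star"] less_ereal.simps(1) by blast
      have "((\<lambda>\<epsilon>. (1 / (1 + \<epsilon>))\<^sup>2 * lam_star - 4 * \<epsilon>) \<longlongrightarrow> (1 / (1 + 0))\<^sup>2 * lam_star - 4 * 0) (at_right 0)"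
        by (intro tendsto_intros) auto
      then have "\<forall>\<^sub>F \<epsilon> in at_right 0. mu < (1 / (1 + \<epsilon>))\<^sup>2 * lam_star - 4 * \<epsilon>"
        using mu(2) by (intro order_tendstoD) auto
      then have "\<forall>\<^sub>F \<epsilon> in at_right 0. mu < (1 / (1 + \<epsilon>))\<^sup>2 * lam_star - 4 * \<epsilon> \<and> 0 < \<epsilon>"
        using eventually_at_right_less by (rule eventually_conj)
      then obtain \<epsilon> where \<epsilon>: "mu < (1 / (1 + \<epsilon>))\<^sup>2 * lam_star - 4 * \<epsilon>" "\<epsilon> > 0"
        using eventually_happens'[OF trivial_limit_at_right_real] by blast
      obtain \<phi> where \<phi>: "Ck 2 \<phi>" "\<And>x. norm (grad \<phi> x) \<le> 1"
        "\<And>x. (1 / (1 + \<epsilon>))\<^sup>2 * lam_star - 4 * \<epsilon> \<le> laplacian \<phi> x + f x"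
        using exists_smooth_subsolution[OF sub cu growth f assms(4) \<epsilon>(2)] by blast
      have "ereal mu \<le> (INF x. ereal (laplacian \<phi> x + f x))"
        using \<epsilon>(1) \<phi>(3) by (intro INF_greatest) (force intro: order_trans[OF less_imp_le])
      also have "\<dots> \<le> lambda_minus f"
        unfolding lambda_minus_def using \<phi>(1,2) by (intro SUP_upper) auto
      finally show False using mu(1) by simp
    qed
  qed
  show plus: "ereal lam_star \<le> lambda_plus f"
    unfolding lambda_plus_def
  proof (rule INF_greatest, rule ccontr)
    fix \<psi> :: "real ^ 'n \<Rightarrow> real"
    assume "\<psi> \<in> {\<psi>. Ck 2 \<psi> \<and> liminf_growth_ge_1 \<psi>}"
    then have \<psi>: "Ck 2 \<psi>" "liminf_growth_ge_1 \<psi>" by blast+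
    assume "\<not> ereal lam_star \<le> (SUP x\<in>{x. norm (grad \<psi> x) < 1}. ereal (laplacian \<psi> x + f x))"
    then have "(SUP x\<in>{x. norm (grad \<psi> x) < 1}. ereal (laplacian \<psi> x + f x)) < ereal lam_star"
      by (simp only: not_le)
    then obtain M where M: "(SUP x\<in>{x. norm (grad \<psi> x) < 1}. ereal (laplacian \<psi> x + f x)) < ereal M"
        "ereal M < ereal lam_star"
      using ereal_dense2 by blast
    have "laplacian \<psi> x + f x \<le> M" if "norm (grad \<psi> x) < 1" for x
      using SUP_lessD[OF M(1), of x] that by simp
    then have "lam_star \<le> M"
      by (rule classical_supersolution_bound[OF sub cu growth f(2) \<psi>])
    with M(2) show False by simp
  qed
  assume "\<exists>\<psi>. Ck 2 \<psi> \<and> visc_supersolution f lam_star \<psi> \<and> liminf_growth_ge_1 \<psi>"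
  then obtain \<psi> where \<psi>: "Ck 2 \<psi>" "visc_supersolution f lam_star \<psi>" "liminf_growth_ge_1 \<psi>" by blast
  have pde: "0 \<le> pde_op f lam_star \<psi> x" for x
    using \<psi>(1,2) unfolding visc_supersolution_def by (auto simp: local_min_at_def)
  have "laplacian \<psi> x + f x \<le> lam_star" if "norm (grad \<psi> x) < 1" for x
    using pde[of x] that by (simp add: pde_op_def max_def split: if_splits)
  then have "(SUP x\<in>{x. norm (grad \<psi> x) < 1}. ereal (laplacian \<psi> x + f x)) \<le> ereal lam_star"
    by (intro SUP_least) auto
  moreover have "lambda_plus f \<le> (SUP x\<in>{x. norm (grad \<psi> x) < 1}. ereal (laplacian \<psi> x + f x))"
    unfolding lambda_plus_def using \<psi> by (intro INF_lower) auto
  ultimately show "ereal lam_star = lambda_plus f" using plus by (intro antisym) auto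
qed

end
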